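(* Let $k>1$ be an integer, $T:\mathbb{T}\to\mathbb{T}$, $T(x)=kx \bmod 1$, and $H\in C^4(\mathbb{T},\mathbb{R})$. Let $T_0:=T$ and let $\{T_\epsilon\}_{0<\epsilon<\epsilon_*}$ (for some $\epsilon_*>0$) be maps in $C^4(\mathbb{T},\mathbb{T})$ such that $\|T-T_\epsilon\|_{C^4}\le\epsilon$ for every $\epsilon$, and there is $\sigma'$ with $T_\epsilon'(x)\ge\sigma'>1$ for each $x\in\mathbb{T}$ and each $\epsilon$. For $\delta>0$ let $\mathcal{L}^{(\epsilon)}_\delta$ be the self-consistent transfer operator acting on probability densities $h$ by $$\mathcal{L}^{(\epsilon)}_\delta h=(T_\epsilon)_*\Lambda_{\delta,h}h .$$ Then for each $\delta>0$ there exists $\epsilon_0\in(0,\epsilon_* )$ such that, for every choice, for each $\epsilon\in[0,\epsilon_0]$, of a probability density $h_\epsilon\in W^{3,1}(\mathbb{T})$ which is a fixed point of $\mathcal{L}^{(\epsilon)}_\delta$, there are $C,\varrho,\lambda>0$ such that for each $\epsilon\in[0,\epsilon_0]$ and each probability density $\eta\in W^{1,1}(\mathbb{T})$ with $\|h_\epsilon-\eta\|_{W^{1,1}}\le\varrho$, $$\|h_\epsilon-[\mathcal{L}^{(\epsilon)}_\delta]^n\eta\|_{W^{1,1}}\le Ce^{-\lambda n}\qquad\text{for all }n\in\mathbb{N}.$$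
   Context: $\mathbb{T}=\mathbb{R}/\mathbb{Z}$ with Lebesgue measure $m$. For an expanding map $S:\mathbb{T}\to\mathbb{T}$, $S_*$ is its transfer operator on densities, $S_*f(x)=\sum_{y\in S^{-1}(x)}\frac{f(y)}{|S'(y)|}$. The mean-field coupling map associated with a density $h$ is the translation $\Phi_{\delta,h}(x)=x+\delta\int_{\mathbb{T}}H\,h\,dm \bmod 1$, and $\Lambda_{\delta,h}$ is its transfer operator, $\Lambda_{\delta,h}(f)(x)=f\left(x-\delta\int_{\mathbb{T}}H\,h\,dm\right)$. *)

theory Defs
  imports "HOL-Analysis.Analysis"
begin

text \<open>
  Conventions. A function on the circle \<open>\<real>/\<int>\<close> is a 1-periodic function on the reals. A map from the
  circle to itself is given by a lift, i.e. a function \<open>F\<close> on the reals with \<open>F (x + 1) = F x + d\<close>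
  for some integer \<open>d\<close>; two lifts give the same circle map iff they differ by an integer constant, and
  none of the notions below (regularity, distance, derivative, transfer operator) depends on the
  choice of the lift. Lebesgue measure on the circle is Lebesgue measure on \<open>[0,1)\<close>. Elements of \<open>L\<^sup>1\<close>
  and of the Sobolev spaces are represented by functions, so equality between them is equality
  almost everywhere.
\<close>

definition circle_fun :: "(real \<Rightarrow> real) \<Rightarrow> bool" where
  "circle_fun f \<longleftrightarrow> (\<forall>x. f (x + 1) = f x)"

definition circle_lift :: "(real \<Rightarrow> real) \<Rightarrow> bool" where
  "circle_lift F \<longleftrightarrow> (\<exists>d::int. \<forall>x. F (x + 1) = F x + of_int d)"

definition C_diff :: "nat \<Rightarrow> (real \<Rightarrow> real) \<Rightarrow> bool" where
  "C_diff n f \<longleftrightarrow>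
     (\<forall>i<n. \<forall>x. ((deriv ^^ i) f) field_differentiable (at x)) \<and>
     continuous_on UNIV ((deriv ^^ n) f)"

text \<open>
  \<open>C_dist n F G\<close> is the size in \<open>C\<^sup>n\<close> of the difference of the circle maps with lifts \<open>F\<close> and \<open>G\<close>, that
  is the maximum of the uniform norms of its derivatives of order at most \<open>n\<close>. In order zero the
  values \<open>F x\<close> and \<open>G x\<close> are compared modulo 1, in the quotient metric of \<open>\<real>/\<int>\<close>.
\<close>

definition C_dist :: "nat \<Rightarrow> (real \<Rightarrow> real) \<Rightarrow> (real \<Rightarrow> real) \<Rightarrow> real" where
  "C_dist n F G =
     (MAX i\<in>{..n}. SUP x. if i = 0 then infdist (F x - G x) \<int>
                          else \<bar>(deriv ^^ i) F x - (deriv ^^ i) G x\<bar>)"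

definition circle_int :: "(real \<Rightarrow> real) \<Rightarrow> real" where
  "circle_int f = (LINT x:{0..<1}|lebesgue. f x)"

definition circle_L1 :: "(real \<Rightarrow> real) set" where
  "circle_L1 = {f. circle_fun f \<and> set_integrable lebesgue {0..<1} f}"

definition prob_density :: "(real \<Rightarrow> real) \<Rightarrow> bool" where
  "prob_density h \<longleftrightarrow> h \<in> circle_L1 \<and> (AE x in lebesgue. 0 \<le> h x) \<and> circle_int h = 1"

text \<open>There are no boundary terms on the circle, so all smooth periodic functions are test functions.\<close>

definition has_weak_deriv :: "(real \<Rightarrow> real) \<Rightarrow> (real \<Rightarrow> real) \<Rightarrow> bool" where
  "has_weak_deriv f g \<longleftrightarrow> f \<in> circle_L1 \<and> g \<in> circle_L1 \<and>
     (\<forall>\<phi>. circle_fun \<phi> \<and> (\<forall>n. C_diff n \<phi>) \<longrightarrow>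
        circle_int (\<lambda>x. f x * deriv \<phi> x) = - circle_int (\<lambda>x. g x * \<phi> x))"

text \<open>\<open>W1 k\<close> is the Sobolev space \<open>W\<^sup>k\<^sup>,\<^sup>1\<close> of the circle.\<close>

primrec W1 :: "nat \<Rightarrow> (real \<Rightarrow> real) set" where
  "W1 0 = circle_L1"
| "W1 (Suc k) = {f. \<exists>g\<in>W1 k. has_weak_deriv f g}"

text \<open>The weak derivative is unique up to null sets, so the choice does not affect the norm.\<close>

definition weak_deriv :: "(real \<Rightarrow> real) \<Rightarrow> real \<Rightarrow> real" where
  "weak_deriv f = (SOME g. has_weak_deriv f g)"

text \<open>The norm is infinite outside the space, so that a finite bound on it includes membership.\<close>

definition W1_norm :: "nat \<Rightarrow> (real \<Rightarrow> real) \<Rightarrow> ennreal" where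
  "W1_norm k f =
     (if f \<in> W1 k then ennreal (\<Sum>i\<le>k. circle_int (\<lambda>x. \<bar>(weak_deriv ^^ i) f x\<bar>)) else \<infinity>)"

text \<open>
  The sum ranges over the preimages, each represented in \<open>[0,1)\<close>, of the class of \<open>x\<close> modulo 1 under
  the circle map with lift \<open>F\<close>. For an expanding map this set is finite.
\<close>

definition transfer_op :: "(real \<Rightarrow> real) \<Rightarrow> (real \<Rightarrow> real) \<Rightarrow> real \<Rightarrow> real" where
  "transfer_op F f x = (\<Sum>y\<in>{y\<in>{0..<1}. F y - x \<in> \<int>}. f y / \<bar>deriv F y\<bar>)"

definition mean_field_map :: "(real \<Rightarrow> real) \<Rightarrow> real \<Rightarrow> (real \<Rightarrow> real) \<Rightarrow> real \<Rightarrow> real" where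
  "mean_field_map H \<delta> h x = x + \<delta> * circle_int (\<lambda>y. H y * h y)"

definition mean_field_op ::
    "(real \<Rightarrow> real) \<Rightarrow> real \<Rightarrow> (real \<Rightarrow> real) \<Rightarrow> (real \<Rightarrow> real) \<Rightarrow> real \<Rightarrow> real" where
  "mean_field_op H \<delta> h f x = f (x - \<delta> * circle_int (\<lambda>y. H y * h y))"

lemma circle_fun_of_int:
  assumes "circle_fun f"
  shows "f (x + of_int n) = f x"
proof (induction n rule: int_induct[where k = 0])
  case (step1 i)
  then show ?case
    using assms unfolding circle_fun_def by (metis add.assoc of_int_1 of_int_add)
next
  case (step2 i)
  have "f (x + of_int (i - 1)) = f (x + of_int (i - 1) + 1)"
    using assms by (metis circle_fun_def)
  then show ?case using step2 by simp
qed simp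

lemma transfer_op_mean_field_map:
  assumes "circle_fun f"
  shows "transfer_op (mean_field_map H \<delta> h) f = mean_field_op H \<delta> h f"
proof
  fix x
  define c where "c = \<delta> * circle_int (\<lambda>y. H y * h y)"
  have Phi: "mean_field_map H \<delta> h = (\<lambda>x. x + c)"
    by (auto simp: mean_field_map_def c_def)
  have "y = frac (x - c)" if y: "0 \<le> y" "y < 1" "y + c - x \<in> \<int>" for y
  proof -
    have "x - c - y \<in> \<int>"
      using Ints_minus[OF y(3)] by (simp add: algebra_simps)
    then show ?thesis
      using y frac_unique_iff[of "x - c" y] by simp
  qed
  moreover have "frac (x - c) + c - x \<in> \<int>"
    by (simp add: frac_def)
  ultimately have "{y\<in>{0..<1}. y + c - x \<in> \<int>} = {frac (x - c)}"
    by (auto simp: frac_lt_1)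
  moreover have "deriv (\<lambda>x. x + c) y = 1" for y :: real
    by (rule DERIV_imp_deriv) (auto intro!: derivative_eq_intros)
  moreover have "f (frac (x - c)) = f (x - c)"
    using circle_fun_of_int[OF assms, of "x - c" "- \<lfloor>x - c\<rfloor>"] by (simp add: frac_def)
  ultimately show "transfer_op (mean_field_map H \<delta> h) f x = mean_field_op H \<delta> h f x"
    by (simp add: transfer_op_def mean_field_op_def Phi flip: c_def)
qed

text \<open>\<open>self_consistent_op F H \<delta>\<close> is the nonlinear operator \<open>h \<mapsto> F\<^sub>* \<Lambda>\<^sub>\<delta>\<^sub>,\<^sub>h h\<close>.\<close>

definition self_consistent_op ::
    "(real \<Rightarrow> real) \<Rightarrow> (real \<Rightarrow> real) \<Rightarrow> real \<Rightarrow> (real \<Rightarrow> real) \<Rightarrow> real \<Rightarrow> real" where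
  "self_consistent_op F H \<delta> h = transfer_op F (mean_field_op H \<delta> h h)"

end

theory Submission
  imports Defs
begin

text \<open>
  On \<open>W\<^sup>1\<^sup>,\<^sup>1\<close> functions of mean zero the seminorm \<open>D f = \<parallel>f'\<parallel>\<close> in \<open>L\<^sup>1\<close> is equivalent to the full norm.
  With \<open>w = 1 / T'\<close> one has \<open>(T\<^sub>* f)' = T\<^sub>* (w f' + w' f)\<close>, and \<open>T\<^sub>*\<close> contracts \<open>L\<^sup>1\<close>; for \<open>T\<close> within \<open>\<epsilon>\<close>
  of \<open>x \<mapsto> k x\<close> we have \<open>w \<le> 2/3\<close> and \<open>w', w'' = O(\<epsilon>)\<close>. Applied twice to a fixed density \<open>h\<close>, this
  Lasota-Yorke estimate gives \<open>\<parallel>h'\<parallel>, \<parallel>h''\<parallel> = O(\<epsilon>)\<close>. Since the translations attached to \<open>h\<close> and \<open>\<eta>\<close>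
  differ by \<open>O(\<delta> D (h - \<eta>))\<close>, the nonlinear part of the operator costs only \<open>O(\<delta> \<epsilon>) D (h - \<eta>)\<close>, so one
  step multiplies \<open>D (h - \<eta>)\<close> by at most \<open>2/3 + O((1 + \<delta>) \<epsilon>)\<close>, whatever the density \<open>\<eta>\<close> in \<open>W\<^sup>1\<^sup>,\<^sup>1\<close>.
  All \<open>L\<^sup>1\<close> bounds on weak derivatives are obtained by duality with continuous test functions.
\<close>

section \<open>Smooth functions on the circle\<close>

text \<open>Splitting off the innermost derivative, not the outermost, suits inductions on
  \<open>n\<close> in which the function is arbitrary.\<close>

lemma C_diff_Suc:
  "C_diff (Suc n) f \<longleftrightarrow> (\<forall>x. f field_differentiable (at x)) \<and> C_diff n (deriv f)"
  unfolding C_diff_def by (simp add: All_less_Suc2 funpow_Suc_right del: funpow.simps(2))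

lemma C_diff_SucI:
  assumes "\<And>x. (f has_real_derivative f' x) (at x)" and "C_diff n f'"
  shows "C_diff (Suc n) f"
proof -
  have "deriv f = f'"
    using assms(1) by (auto intro: DERIV_imp_deriv)
  with assms show ?thesis
    by (auto simp: C_diff_Suc field_differentiable_def)
qed

lemma C_diff_Suc_imp: "C_diff (Suc n) f \<Longrightarrow> C_diff n f"
  by (auto simp: C_diff_def intro!: continuous_at_imp_continuous_on field_differentiable_imp_continuous_at)

lemma C_diff_has_derivative:
  "C_diff (Suc n) f \<Longrightarrow> (f has_real_derivative deriv f x) (at x)"
  by (simp add: C_diff_Suc field_differentiable_derivI DERIV_deriv_iff_field_differentiable)

lemma C_diff_imp_continuous: "C_diff n f \<Longrightarrow> continuous_on UNIV f"
proof (induction n)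
  case (Suc n) then show ?case using C_diff_Suc_imp by blast
qed (simp add: C_diff_def)

lemma C_diff_const: "C_diff n (\<lambda>x. c)"
proof (induction n arbitrary: c)
  case (Suc n)
  show ?case by (rule C_diff_SucI[of _ "\<lambda>_. 0"]) (auto intro: Suc)
qed (simp add: C_diff_def)

lemma C_diff_add: "C_diff n f \<Longrightarrow> C_diff n g \<Longrightarrow> C_diff n (\<lambda>x. f x + g x)"
proof (induction n arbitrary: f g)
  case (Suc n)
  show ?case
  proof (rule C_diff_SucI)
    show "((\<lambda>x. f x + g x) has_real_derivative deriv f x + deriv g x) (at x)" for x
      using Suc.prems by (auto intro!: derivative_eq_intros dest: C_diff_has_derivative)
    show "C_diff n (\<lambda>x. deriv f x + deriv g x)"
      using Suc by (simp add: C_diff_Suc)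
  qed
qed (auto simp: C_diff_def intro!: continuous_intros)

lemma C_diff_mult: "C_diff n f \<Longrightarrow> C_diff n g \<Longrightarrow> C_diff n (\<lambda>x. f x * g x)"
proof (induction n arbitrary: f g)
  case (Suc n)
  show ?case
  proof (rule C_diff_SucI)
    show "((\<lambda>x. f x * g x) has_real_derivative deriv f x * g x + f x * deriv g x) (at x)" for x
      using Suc.prems by (auto intro!: derivative_eq_intros dest: C_diff_has_derivative)
    show "C_diff n (\<lambda>x. deriv f x * g x + f x * deriv g x)"
      using Suc by (auto intro!: C_diff_add simp: C_diff_Suc C_diff_Suc_imp)
  qed
qed (auto simp: C_diff_def intro!: continuous_intros)

text \<open>Both coefficients are kept general so that the induction closes: differentiation sends
  the pair \<open>a\<close>, \<open>b\<close> to \<open>b * w\<close>,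
  \<open>- a * w\<close>.\<close>

lemma C_diff_trig: "C_diff n (\<lambda>x. a * cos (w * x) + b * sin (w * x))"
proof (induction n arbitrary: a b)
  case (Suc n)
  show ?case
    by (rule C_diff_SucI[OF _ Suc[of "b * w" "- a * w"]])
      (auto intro!: derivative_eq_intros simp: algebra_simps)
qed (auto simp: C_diff_def intro!: continuous_intros)

section \<open>Uniform approximation by smooth periodic functions, and periodic
  antiderivatives\<close>

text \<open>On the unit circle a real linear functional is a combination of cosine and sine, so real
  polynomials restrict to trigonometric polynomials.\<close>

lemma smooth_real_polynomial_cis:
  fixes p :: "complex \<Rightarrow> real"
  assumes "real_polynomial_function p"
  shows "C_diff n (\<lambda>t. p (cis (2 * pi * t)))"
  using assms
proof (induction arbitrary: n)
  case (linear f)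
  interpret bounded_linear f by fact
  have "cis t = cos t *\<^sub>R 1 + sin t *\<^sub>R \<i>" for t
    by (simp add: complex_eq_iff)
  then have "f (cis t) = f 1 * cos t + f \<i> * sin t" for t
    by (simp only: add scaleR) simp
  then show ?case
    using C_diff_trig[of n "f 1" "2 * pi" "f \<i>"] by simp
qed (auto intro: C_diff_const C_diff_add C_diff_mult)

lemma circle_fun_frac: "circle_fun f \<Longrightarrow> f (frac x) = f x"
  using circle_fun_of_int[of f x "- \<lfloor>x\<rfloor>"] by (simp add: frac_def)

text \<open>Stone-Weierstrass on the unit circle in the complex plane: \<open>f\<close> is
  transported there as \<open>F\<close>, approximated by a real polynomial, and pulled back along
  \<open>u\<close>.\<close>

lemma smooth_dense:
  assumes "circle_fun f" "continuous_on UNIV f" "e > 0"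
  obtains p where "circle_fun p" "\<And>n. C_diff n p" "\<And>x. \<bar>f x - p x\<bar> < e"
proof -
  define u where "u = (\<lambda>t::real. cis (2 * pi * t))"
  define F where "F z = f (Arg2pi z / (2 * pi))" for z
  have contu: "continuous_on S u" for S
    unfolding u_def by (intro continuous_intros)
  have Fu: "F (u t) = f t" for t
  proof -
    obtain k where "t = frac t + of_int k"
      by (metis add.commute frac_def diff_add_cancel)
    have "Arg2pi (u t) = 2 * pi * frac t"
    proof (rule Arg2pi_unique[of 1])
      have "u t = u (frac t)"
        unfolding u_def frac_def
        by (simp add: right_diff_distrib cis_divide[symmetric] cis_multiple_2pi)
      then show "complex_of_real 1 * exp (\<i> * complex_of_real (2 * pi * frac t)) = u t"
        by (simp add: u_def cis_conv_exp)
    qed (use frac_lt_1[of t] in auto)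
    then show ?thesis
      by (simp add: F_def circle_fun_frac assms)
  qed
  have sph: "sphere 0 1 = u ` {0..1}"
  proof (intro subset_antisym subsetI)
    fix z :: complex assume "z \<in> sphere 0 1"
    then have "z = u (Arg2pi z / (2 * pi))"
      using Arg2pi_eq[of z] by (simp add: u_def cis_conv_exp)
    moreover have "Arg2pi z / (2 * pi) \<in> {0..1}"
      using Arg2pi_ge_0[of z] Arg2pi_lt_2pi[of z] by (auto simp: field_simps)
    ultimately show "z \<in> u ` {0..1}" by blast
  qed (auto simp: u_def)
  \<comment> \<open>\<open>Arg2pi\<close> jumps at 1, so continuity is not a matter of composition.
    The graph of \<open>F\<close> is a continuous image of the compact interval [0,1], hence closed,
    and \<open>F\<close> takes values in a compact set.\<close>
  have "continuous_on (sphere 0 1) F"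
  proof (rule continuous_from_closed_graph)
    show "compact (f ` {0..1})"
      using assms(2) by (intro compact_continuous_image) (auto intro: continuous_on_subset)
    show "F \<in> sphere 0 1 \<rightarrow> f ` {0..1}"
      using Fu by (auto simp: sph)
    have "(\<lambda>z. (z, F z)) ` sphere 0 1 = (\<lambda>t. (u t, f t)) ` {0..1}"
      using Fu by (force simp: sph)
    moreover have "compact \<dots>"
      using assms(2) by (intro compact_continuous_image continuous_on_Pair contu)
        (auto intro: continuous_on_subset)
    ultimately show "closed ((\<lambda>z. (z, F z)) ` sphere 0 1)"
      by (simp add: compact_imp_closed)
  qed
  then obtain g where g: "real_polynomial_function g" "\<And>z. z \<in> sphere 0 1 \<Longrightarrow> \<bar>F z - g z\<bar> < e"
    using Stone_Weierstrass_real_polynomial_function[of "sphere 0 1" F e] assms(3)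
    by (metis compact_sphere)
  show ?thesis
  proof
    show "circle_fun (\<lambda>t. g (u t))"
      by (simp add: circle_fun_def u_def distrib_left cis_mult[symmetric])
    show "C_diff n (\<lambda>t. g (u t))" for n
      using smooth_real_polynomial_cis[OF g(1)] by (simp add: u_def)
    show "\<bar>f x - g (u x)\<bar> < e" for x
      using g(2)[of "u x"] by (simp add: Fu) (simp add: u_def)
  qed
qed

text \<open>The number \<open>m\<close> is the mean of \<open>p\<close> over a period; subtracting
  it is what makes an antiderivative periodic. The explicit bounds make \<open>P\<close> usable as a
  test function in duality estimates.\<close>

lemma circle_antiderivative:
  assumes "circle_fun p" "continuous_on UNIV p"
  obtains P m where "circle_fun P" "\<And>x. (P has_real_derivative p x - m) (at x)"
    "\<And>K x. (\<And>y. \<bar>p y\<bar> \<le> K) \<Longrightarrow> \<bar>m\<bar> \<le> K \<and> \<bar>P x\<bar> \<le> 2 * K"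
proof -
  have "\<exists>Q. \<forall>x. - \<infinity> < ereal x \<longrightarrow> ereal x < \<infinity> \<longrightarrow> (Q has_vector_derivative p x) (at x)"
    using assms(2) by (intro einterval_antiderivative) (auto simp: continuous_on_eq_continuous_at)
  then obtain Q where Q: "\<And>x. (Q has_real_derivative p x) (at x)"
    by (auto simp: has_real_derivative_iff_has_vector_derivative)
  define m where "m = Q 1 - Q 0"
  define P where "P x = Q x - Q 0 - m * x" for x
  have P: "(P has_real_derivative p x - m) (at x)" for x
    unfolding P_def by (auto intro!: derivative_eq_intros Q)
  \<comment> \<open>Periodicity of \<open>P\<close>: the increment over a period has derivative
    zero, so it is constant, and it vanishes at 0 by the choice of \<open>m\<close>.\<close>
  have "((\<lambda>x. P (x + 1) - P x) has_real_derivative (p (x + 1) - m) - (p x - m)) (at x)" for x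
    using P[of "x + 1"] P[of x] by (intro DERIV_diff) (auto simp: DERIV_shift)
  then have "((\<lambda>x. P (x + 1) - P x) has_real_derivative 0) (at x)" for x
    using assms(1) by (simp add: circle_fun_def)
  then have "P (x + 1) - P x = P (0 + 1) - P 0" for x
    using DERIV_isconst_all[of "\<lambda>x. P (x + 1) - P x" x 0] by blast
  moreover have "P 1 = P 0"
    by (simp add: P_def m_def)
  ultimately have cP: "circle_fun P"
    by (simp add: circle_fun_def)
  have "\<bar>m\<bar> \<le> K \<and> \<bar>P x\<bar> \<le> 2 * K" if K: "\<And>y. \<bar>p y\<bar> \<le> K" for K x
  proof -
    have lip: "\<bar>Q b - Q a\<bar> \<le> K * \<bar>b - a\<bar>" for a b
      using field_differentiable_bound[of UNIV Q p K b a] K Q by auto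
    have m: "\<bar>m\<bar> \<le> K"
      using lip[of 1 0] by (simp add: m_def)
    have fr: "0 \<le> frac x" "frac x \<le> 1"
      using frac_lt_1[of x] by (auto intro: less_imp_le)
    have "\<bar>P (frac x)\<bar> \<le> \<bar>Q (frac x) - Q 0\<bar> + \<bar>m\<bar> * \<bar>frac x\<bar>"
      using fr abs_triangle_ineq4[of "Q (frac x) - Q 0" "m * frac x"] by (simp add: P_def abs_mult)
    also have "\<dots> \<le> K * frac x + K * frac x"
      using lip[of "frac x" 0] mult_right_mono[OF m fr(1)] fr by (intro add_mono) auto
    also have "\<dots> \<le> K * 1 + K * 1"
      using m fr by (intro add_mono mult_left_mono) auto
    finally show ?thesis
      using m by (simp add: circle_fun_frac cP)
  qed
  with that cP P show ?thesis by blast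
qed

section \<open>Integration on the circle\<close>

abbreviation L1_norm :: "(real \<Rightarrow> real) \<Rightarrow> real" where
  "L1_norm f \<equiv> circle_int (\<lambda>x. \<bar>f x\<bar>)"

lemma circle_int_eq: "circle_int f = integral\<^sup>L (lebesgue_on {0..<1}) f"
  by (simp add: circle_int_def set_lebesgue_integral_def integral_restrict_space)

lemma circle_L1_iff: "f \<in> circle_L1 \<longleftrightarrow> circle_fun f \<and> integrable (lebesgue_on {0..<1}) f"
  by (simp add: circle_L1_def set_integrable_def integrable_restrict_space)

lemma circle_fun_add: "circle_fun f \<Longrightarrow> circle_fun g \<Longrightarrow> circle_fun (\<lambda>x. f x + g x)"
  and circle_fun_diff: "circle_fun f \<Longrightarrow> circle_fun g \<Longrightarrow> circle_fun (\<lambda>x. f x - g x)"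
  and circle_fun_mult: "circle_fun f \<Longrightarrow> circle_fun g \<Longrightarrow> circle_fun (\<lambda>x. f x * g x)"
  by (auto simp: circle_fun_def)

lemma circle_fun_bounded:
  fixes f :: "real \<Rightarrow> real"
  assumes "circle_fun f" "continuous_on UNIV f"
  obtains K where "\<And>x. \<bar>f x\<bar> \<le> K"
proof -
  have "compact (f ` {0..1})"
    using assms(2) by (intro compact_continuous_image) (auto intro: continuous_on_subset)
  then obtain K where K: "\<And>x. x \<in> {0..1} \<Longrightarrow> \<bar>f x\<bar> \<le> K"
    by (fastforce dest!: compact_imp_bounded simp: bounded_iff)
  have "\<bar>f x\<bar> \<le> K" for x
    using K[of "frac x"] frac_lt_1[of x] by (simp add: circle_fun_frac assms(1) less_imp_le)
  then show ?thesis by (rule that)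
qed

lemma circle_L1_add: "f \<in> circle_L1 \<Longrightarrow> g \<in> circle_L1 \<Longrightarrow> (\<lambda>x. f x + g x) \<in> circle_L1"
  and circle_L1_diff: "f \<in> circle_L1 \<Longrightarrow> g \<in> circle_L1 \<Longrightarrow> (\<lambda>x. f x - g x) \<in> circle_L1"
  and circle_L1_abs: "f \<in> circle_L1 \<Longrightarrow> (\<lambda>x. \<bar>f x\<bar>) \<in> circle_L1"
  by (auto simp: circle_L1_iff circle_fun_def)

lemma circle_int_add:
    "f \<in> circle_L1 \<Longrightarrow> g \<in> circle_L1 \<Longrightarrow> circle_int (\<lambda>x. f x + g x) = circle_int f + circle_int g"
  and circle_int_diff:
    "f \<in> circle_L1 \<Longrightarrow> g \<in> circle_L1 \<Longrightarrow> circle_int (\<lambda>x. f x - g x) = circle_int f - circle_int g"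
  by (auto simp: circle_L1_iff circle_int_eq)

lemma circle_L1_mult:
  assumes f: "f \<in> circle_L1" and \<phi>: "circle_fun \<phi>" "continuous_on UNIV \<phi>"
  shows "(\<lambda>x. f x * \<phi> x) \<in> circle_L1"
proof -
  obtain K where K: "\<And>x. \<bar>\<phi> x\<bar> \<le> K"
    using circle_fun_bounded[OF \<phi>] by blast
  have "integrable (lebesgue_on {0..<1}) (\<lambda>x. f x * \<phi> x)"
  proof (rule Bochner_Integration.integrable_bound)
    show "integrable (lebesgue_on {0..<1}) (\<lambda>x. K * f x)"
      using f by (simp add: circle_L1_iff)
    have "\<phi> \<in> borel_measurable (lebesgue_on {0..<1})"
      using \<phi>(2) by (intro continuous_imp_measurable_on_sets_lebesgue) (auto intro: continuous_on_subset)
    then show "(\<lambda>x. f x * \<phi> x) \<in> borel_measurable (lebesgue_on {0..<1})"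
      using f by (auto simp: circle_L1_iff intro: borel_measurable_integrable)
    show "AE x in lebesgue_on {0..<1}. norm (f x * \<phi> x) \<le> norm (K * f x)"
    proof (intro AE_I2)
      fix x
      show "norm (f x * \<phi> x) \<le> norm (K * f x)"
        using mult_right_mono[OF order_trans[OF K abs_ge_self], of "\<bar>f x\<bar>" x]
        by (simp add: abs_mult mult.commute)
    qed
  qed
  with f \<phi> show ?thesis by (simp add: circle_L1_iff circle_fun_mult)
qed

lemma circle_L1_cmult: "f \<in> circle_L1 \<Longrightarrow> (\<lambda>x. c * f x) \<in> circle_L1"
  using circle_L1_mult[of f "\<lambda>_. c"] by (simp add: circle_fun_def mult.commute)

lemma circle_int_cmult: "circle_int (\<lambda>x. c * f x) = c * circle_int f"
  by (simp add: circle_int_eq)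

lemma circle_int_mono:
  "f \<in> circle_L1 \<Longrightarrow> g \<in> circle_L1 \<Longrightarrow> (\<And>x. f x \<le> g x) \<Longrightarrow> circle_int f \<le> circle_int g"
  by (auto simp: circle_L1_iff circle_int_eq intro!: integral_mono)

lemma circle_int_cong_AE:
  assumes "f \<in> circle_L1" "g \<in> circle_L1" "AE x in lebesgue. f x = g x"
  shows "circle_int f = circle_int g"
  unfolding circle_int_eq using assms
  by (intro integral_cong_AE) (auto simp: circle_L1_iff AE_restrict_space_iff)

lemma L1_norm_nonneg: "0 \<le> L1_norm f"
  by (simp add: circle_int_eq)

lemma L1_norm_add_le:
  assumes "f \<in> circle_L1" "g \<in> circle_L1"
  shows "L1_norm (\<lambda>x. f x + g x) \<le> L1_norm f + L1_norm g"
proof -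
  have "L1_norm (\<lambda>x. f x + g x) \<le> circle_int (\<lambda>x. \<bar>f x\<bar> + \<bar>g x\<bar>)"
    using assms by (intro circle_int_mono circle_L1_abs circle_L1_add abs_triangle_ineq)
  with assms show ?thesis by (simp add: circle_int_add circle_L1_abs)
qed

lemma L1_norm_mult_le:
  assumes f: "f \<in> circle_L1" and \<phi>: "circle_fun \<phi>" "continuous_on UNIV \<phi>" and K: "\<And>x. \<bar>\<phi> x\<bar> \<le> K"
  shows "L1_norm (\<lambda>x. f x * \<phi> x) \<le> K * L1_norm f"
proof -
  have "\<bar>f x * \<phi> x\<bar> \<le> K * \<bar>f x\<bar>" for x
    using mult_right_mono[OF K[of x], of "\<bar>f x\<bar>"] by (simp add: abs_mult mult.commute)
  then have "L1_norm (\<lambda>x. f x * \<phi> x) \<le> circle_int (\<lambda>x. K * \<bar>f x\<bar>)"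
    using assms by (intro circle_int_mono circle_L1_abs circle_L1_cmult circle_L1_mult)
  then show ?thesis by (simp add: circle_int_cmult)
qed

lemma abs_circle_int_le: "\<bar>circle_int f\<bar> \<le> L1_norm f"
  by (simp add: circle_int_eq)

lemma abs_circle_int_mult_le:
  assumes "f \<in> circle_L1" "circle_fun \<phi>" "continuous_on UNIV \<phi>" "\<And>x. \<bar>\<phi> x\<bar> \<le> K"
  shows "\<bar>circle_int (\<lambda>x. f x * \<phi> x)\<bar> \<le> K * L1_norm f"
  using abs_circle_int_le L1_norm_mult_le[OF assms] by (rule order_trans)

lemma L1_norm_diff_eq_0:
  assumes "f \<in> circle_L1" "g \<in> circle_L1" "AE x in lebesgue. f x = g x"
  shows "L1_norm (\<lambda>x. f x - g x) = 0"
proof -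
  have "(\<lambda>x. 0) \<in> circle_L1"
    by (simp add: circle_L1_iff circle_fun_def)
  moreover have "AE x in lebesgue. \<bar>f x - g x\<bar> = 0"
    using assms(3) by simp
  ultimately have "L1_norm (\<lambda>x. f x - g x) = circle_int (\<lambda>x. 0)"
    by (rule circle_int_cong_AE[OF circle_L1_abs[OF circle_L1_diff[OF assms(1,2)]]])
  then show ?thesis by (simp add: circle_int_eq)
qed

section \<open>Duality between the L1 norm and continuous test functions\<close>

lemma isCont_frac:
  fixes x :: real
  assumes "x \<notin> \<int>"
  shows "isCont frac x"
proof -
  have "x < of_int \<lceil>x\<rceil>" "of_int \<lfloor>x\<rfloor> < x"
    using assms by (auto simp: less_le dest: sym) (metis Ints_of_int ceiling_correct floor_correct less_le)+
  then have "eventually (\<lambda>y. y \<in> {of_int \<lfloor>x\<rfloor><..<of_int \<lceil>x\<rceil>}) (nhds x)"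
    by (intro eventually_nhds_in_open) auto
  then have "eventually (\<lambda>y. frac y = y - of_int \<lfloor>x\<rfloor>) (nhds x)"
  proof eventually_elim
    case (elim y)
    then have "\<lfloor>y\<rfloor> = \<lfloor>x\<rfloor>"
      by (intro floor_unique) (auto, use ceiling_le[of x "\<lfloor>x\<rfloor> + 1"] in linarith)
    then show ?case by (simp add: frac_def)
  qed
  then show ?thesis
    by (subst isCont_cong) (auto intro!: continuous_intros)
qed

text \<open>Pairing \<open>g\<close> with its sign gives the norm. The sign is an almost everywhere
  limit of continuous periodic functions bounded by 1, and dominated convergence passes the bound
  \<open>M\<close> to the limit.\<close>

lemma L1_norm_le_dual:
  assumes g: "g \<in> circle_L1"
    and M: "\<And>\<psi>. circle_fun \<psi> \<Longrightarrow> continuous_on UNIV \<psi> \<Longrightarrow> (\<And>x. \<bar>\<psi> x\<bar> \<le> 1) \<Longrightarrow>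
              circle_int (\<lambda>x. g x * \<psi> x) \<le> M"
  shows "L1_norm g \<le> M"
proof -
  let ?I = "lebesgue_on {0..<1::real}"
  have gm: "g \<in> borel_measurable ?I"
    using g by (simp add: circle_L1_iff borel_measurable_integrable)
  then have "(\<lambda>x. sgn (g x)) \<in> borel_measurable ?I"
    by (simp add: sgn_real_def)
  then have "(\<lambda>x. sgn (g x)) measurable_on {0..<1}"
    by (subst measurable_on_iff_borel_measurable) auto
  then obtain N G where N: "negligible N" and G: "\<And>n::nat. continuous_on UNIV (G n)"
    and lim: "\<And>x. x \<notin> N \<Longrightarrow> (\<lambda>n. G n x) \<longlonglongrightarrow> (if x \<in> {0..<1} then sgn (g x) else 0)"
    unfolding measurable_on_def by blast
  \<comment> \<open>\<open>G n\<close> is continuous on the line but neither bounded by 1 nor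
    periodic. It is truncated to [-1,1], evaluated at \<open>frac x\<close>, and multiplied by the
    cutoff \<open>b n\<close>, which vanishes at the integers, where \<open>frac\<close> jumps, and
    tends to 1 elsewhere.\<close>
  define c where "c n x = max (-1) (min 1 (G n x))" for n and x :: real
  define b where "b n x = min 1 (real n * (sin (pi * x))\<^sup>2)" for n and x :: real
  define \<psi> where "\<psi> n x = c n (frac x) * b n x" for n x
  have c: "\<bar>c n x\<bar> \<le> 1" and b: "0 \<le> b n x" "b n x \<le> 1" for n x
    by (auto simp: c_def b_def)
  have cont_c: "continuous_on UNIV (c n)" for n
    unfolding c_def by (intro continuous_intros G)
  have cont_b: "continuous_on UNIV (b n)" for n
    unfolding b_def by (intro continuous_intros)
  have per: "circle_fun (\<psi> n)" for n
    by (simp add: circle_fun_def \<psi>_def b_def frac_1_eq distrib_left sin_add)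
  have \<psi>: "\<bar>\<psi> n x\<bar> \<le> b n x" for n x
    using mult_right_mono[OF c b(1)] b by (simp add: \<psi>_def abs_mult)
  have \<psi>1: "\<bar>\<psi> n x\<bar> \<le> 1" for n x
    using \<psi> b order_trans by blast
  \<comment> \<open>At integers \<open>\<psi> n\<close> is squeezed by \<open>b n\<close>, which
    tends to 0 there; elsewhere \<open>frac\<close> is continuous.\<close>
  have "isCont (\<psi> n) x" for n x
  proof (cases "x \<in> \<int>")
    case True
    then have "b n x = 0"
      by (auto simp: b_def sin_zero_iff_int2 mult.commute elim!: Ints_cases)
    moreover have "(b n \<longlongrightarrow> b n x) (at x)"
      using cont_b by (simp add: continuous_on_eq_continuous_at isCont_def)
    moreover have "\<psi> n x = 0"
      using \<open>b n x = 0\<close> by (simp add: \<psi>_def)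
    ultimately show ?thesis
      using \<psi> by (simp add: isCont_def Lim_null_comparison[of _ "b n"])
  next
    case False
    have "isCont (c n) (frac x)" "isCont (b n) x"
      using cont_c cont_b by (auto simp: continuous_on_eq_continuous_at)
    then show ?thesis
      unfolding \<psi>_def by (intro continuous_intros isCont_o2[OF isCont_frac[OF False]])
  qed
  then have cont: "continuous_on UNIV (\<psi> n)" for n
    by (simp add: continuous_at_imp_continuous_on)
  have "(\<lambda>n. circle_int (\<lambda>x. g x * \<psi> n x)) \<longlonglongrightarrow> circle_int (\<lambda>x. g x * sgn (g x))"
    unfolding circle_int_eq
  proof (rule integral_dominated_convergence)
    show "(\<lambda>x. g x * sgn (g x)) \<in> borel_measurable ?I"
      using gm by (simp add: sgn_real_def)
    show "(\<lambda>x. g x * \<psi> n x) \<in> borel_measurable ?I" for n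
      using circle_L1_mult[OF g per cont] by (simp add: circle_L1_iff borel_measurable_integrable)
    show "integrable ?I (\<lambda>x. \<bar>g x\<bar>)"
      using g by (simp add: circle_L1_iff)
    show "AE x in ?I. norm (g x * \<psi> n x) \<le> \<bar>g x\<bar>" for n
      using \<psi>1 by (auto simp: abs_mult mult_left_le)
    \<comment> \<open>The point 0 is discarded together with \<open>N\<close>, because every cutoff
      \<open>b n\<close> vanishes there.\<close>
    have "AE x in lebesgue. x \<notin> insert 0 N"
      using N by (intro AE_not_in) (simp add: negligible_iff_null_sets[symmetric] negligible_insert)
    then have "AE x in ?I. x \<notin> insert 0 N"
      by (subst AE_restrict_space_iff) (simp, erule eventually_mono, simp)
    then show "AE x in ?I. (\<lambda>n. g x * \<psi> n x) \<longlonglongrightarrow> g x * sgn (g x)"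
    proof (rule AE_mp, intro AE_I2 impI)
      fix x assume "x \<in> space ?I" and "x \<notin> insert 0 N"
      then have x: "0 < x" "x < 1" "x \<notin> N" by auto
      then have "(\<lambda>n. G n x) \<longlonglongrightarrow> sgn (g x)"
        using lim[of x] by simp
      then have "(\<lambda>n. c n x) \<longlonglongrightarrow> max (-1) (min 1 (sgn (g x)))"
        unfolding c_def by (intro tendsto_intros)
      moreover have "max (-1) (min 1 (sgn (g x))) = sgn (g x)"
        by (simp add: sgn_real_def)
      ultimately have 1: "(\<lambda>n. c n x) \<longlonglongrightarrow> sgn (g x)" by simp
      have "sin (pi * x) > 0"
        using x by (intro sin_gt_zero) auto
      then have s: "(sin (pi * x))\<^sup>2 > 0" by simp
      then have "eventually (\<lambda>n. 1 / (sin (pi * x))\<^sup>2 < real n) sequentially"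
        using filterlim_real_sequentially by (simp add: filterlim_at_top_dense)
      then have "eventually (\<lambda>n. b n x = 1) sequentially"
        by eventually_elim (use s in \<open>simp add: b_def field_simps\<close>)
      then have 2: "(\<lambda>n. b n x) \<longlonglongrightarrow> 1"
        by (rule tendsto_eventually)
      have "frac x = x"
        using x by (simp add: frac_eq)
      then have "(\<lambda>n. \<psi> n x) \<longlonglongrightarrow> sgn (g x)"
        unfolding \<psi>_def using tendsto_mult[OF 1 2] by simp
      then show "(\<lambda>n. g x * \<psi> n x) \<longlonglongrightarrow> g x * sgn (g x)"
        by (intro tendsto_intros)
    qed
  qed
  moreover have "circle_int (\<lambda>x. g x * \<psi> n x) \<le> M" for n
    by (intro M per cont \<psi>1)
  ultimately have "circle_int (\<lambda>x. g x * sgn (g x)) \<le> M"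
    by (intro LIMSEQ_le_const2[of "\<lambda>n. circle_int (\<lambda>x. g x * \<psi> n x)"]) auto
  then show ?thesis
    by (simp add: abs_sgn[symmetric])
qed

section \<open>Translations and change of the period interval\<close>

text \<open>Change of variables with derivative 1. Stating it as an equivalence about integrability
  together with a value \<open>I\<close> lets both facts be moved in either direction at
  once.\<close>

lemma absolutely_integrable_shift:
  fixes f :: "real \<Rightarrow> real"
  shows "(\<lambda>x. f (x + c)) absolutely_integrable_on {a..<b} \<and> integral {a..<b} (\<lambda>x. f (x + c)) = I \<longleftrightarrow>
         f absolutely_integrable_on {a + c..<b + c} \<and> integral {a + c..<b + c} f = I"
proof -
  have "inj_on (\<lambda>x::real. x + c) {a..<b}" by (simp add: inj_on_def)
  moreover have "((\<lambda>x. x + c) has_real_derivative 1) (at x within {a..<b})" for x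
    by (auto intro!: derivative_eq_intros)
  ultimately show ?thesis
    using has_absolute_integral_change_of_variables_1'[of "{a..<b}" "\<lambda>x. x + c" "\<lambda>_. 1" f I] by simp
qed

lemma absolutely_integrable_Un_ivl:
  fixes f :: "real \<Rightarrow> real"
  assumes "a \<le> b" "b \<le> c"
  shows "f absolutely_integrable_on {a..<c} \<longleftrightarrow>
      f absolutely_integrable_on {a..<b} \<and> f absolutely_integrable_on {b..<c}"
    and "f absolutely_integrable_on {a..<c} \<Longrightarrow>
      integral {a..<c} f = integral {a..<b} f + integral {b..<c} f"
proof -
  have eq: "{a..<c} = {a..<b} \<union> {b..<c}" using assms by auto
  show *: "f absolutely_integrable_on {a..<c} \<longleftrightarrow>
      f absolutely_integrable_on {a..<b} \<and> f absolutely_integrable_on {b..<c}"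
    by (auto simp: eq intro: set_integrable_Un set_integrable_subset)
  assume "f absolutely_integrable_on {a..<c}"
  with * show "integral {a..<c} f = integral {a..<b} f + integral {b..<c} f"
    unfolding eq by (intro integral_Un) (auto dest: set_lebesgue_integral_eq_integral(1))
qed

lemma circle_fun_integral_period:
  assumes f: "circle_fun f" and fa: "f absolutely_integrable_on {a..<a + 1}"
  shows "f absolutely_integrable_on {b..<b + 1}" "integral {b..<b + 1} f = integral {a..<a + 1} f"
proof -
  have shift: "f absolutely_integrable_on {x + of_int m..<y + of_int m} \<and>
       integral {x + of_int m..<y + of_int m} f = integral {x..<y} f"
    if "f absolutely_integrable_on {x..<y}" for x y m
    using absolutely_integrable_shift[where f=f and c="of_int m" and a=x and b=y and I="integral {x..<y} f"] that
    by (simp add: circle_fun_of_int f)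
  define n where "n = \<lceil>a - b\<rceil>"
  \<comment> \<open>An integer translate \<open>b'\<close> of \<open>b\<close> lies in [a, a+1]. The
    windows starting at \<open>a\<close> and at \<open>b'\<close> share [b', a+1), and what remains
    of the second, [a+1, b'+1), is the translate by 1 of what remains of the first, [a, b').\<close>
  define b' where "b' = b + of_int n"
  have n: "a \<le> b'" "b' \<le> a + 1"
    unfolding n_def b'_def by linarith+
  note 1 = absolutely_integrable_Un_ivl[OF n, of f]
  have "a + 1 \<le> b' + 1" using n by simp
  note 2 = absolutely_integrable_Un_ivl[OF n(2) this, of f]
  have "f absolutely_integrable_on {b'..<b' + 1} \<and> integral {b'..<b' + 1} f = integral {a..<a + 1} f"
    using 1 2 fa shift[of a b' 1] by auto
  then show "f absolutely_integrable_on {b..<b + 1}" "integral {b..<b + 1} f = integral {a..<a + 1} f"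
    using shift[of b' "b' + 1" "- n"] by (auto simp: b'_def algebra_simps)
qed

text \<open>Allows membership to be checked on any window of length 1; translates and transfer
  operators come with windows other than [0,1).\<close>

lemma circle_L1_period: "f \<in> circle_L1 \<longleftrightarrow> circle_fun f \<and> f absolutely_integrable_on {a..<a + 1}"
  using circle_fun_integral_period(1)[of f a 0] circle_fun_integral_period(1)[of f 0 a]
  by (auto simp: circle_L1_def)

lemma circle_int_period:
  assumes "f \<in> circle_L1"
  shows "circle_int f = integral {a..<a + 1} f"
proof -
  have "f absolutely_integrable_on {0..<0 + 1}" "circle_fun f"
    using assms by (auto simp: circle_L1_def)
  from circle_fun_integral_period(2)[OF this(2,1), of a] this(1) show ?thesis
    by (simp add: circle_int_def set_lebesgue_integral_eq_integral)
qed

lemma circle_fun_shift: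
  assumes "circle_fun f"
  shows "circle_fun (\<lambda>x. f (x + c))"
proof -
  have "f (x + 1 + c) = f (x + c)" for x
    using assms by (metis circle_fun_def add.assoc add.commute)
  then show ?thesis by (simp add: circle_fun_def)
qed

lemma circle_shift:
  assumes "f \<in> circle_L1"
  shows "(\<lambda>x. f (x + c)) \<in> circle_L1" "circle_int (\<lambda>x. f (x + c)) = circle_int f"
proof -
  have "f absolutely_integrable_on {c..<c + 1}"
    using assms circle_L1_period by blast
  then have *: "(\<lambda>x. f (x + c)) absolutely_integrable_on {0..<1}"
     "integral {0..<1} (\<lambda>x. f (x + c)) = integral {c..<c + 1} f"
    using absolutely_integrable_shift[where f=f and c=c and a=0 and b=1 and I="integral {c..<c + 1} f"] by (auto simp: add.commute)
  then show "(\<lambda>x. f (x + c)) \<in> circle_L1"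
    using assms by (simp add: circle_L1_def circle_fun_shift)
  then show "circle_int (\<lambda>x. f (x + c)) = circle_int f"
    using * circle_int_period[OF assms, of c] circle_int_period[of "\<lambda>x. f (x + c)" 0] by simp
qed

section \<open>Weak derivatives\<close>

lemma circle_fun_derivative:
  assumes "circle_fun f" "\<And>x. (f has_real_derivative f' x) (at x)"
  shows "circle_fun f'"
  unfolding circle_fun_def
proof
  fix x
  have "((\<lambda>y. f (y + 1)) has_real_derivative f' (x + 1)) (at x)"
    using assms(2) by (simp add: DERIV_shift[symmetric])
  then have "(f has_real_derivative f' (x + 1)) (at x)"
    using assms(1) by (simp add: circle_fun_def)
  then show "f' (x + 1) = f' x"
    using assms(2) DERIV_unique by blast
qed

text \<open>Integration by parts extends from smooth to C1 test functions, since a C1 function is a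
  limit of smooth periodic ones uniformly together with its derivative. Products with weights and
  compositions with lifts yield test functions that are only known to be C1.\<close>

lemma has_weak_deriv_C1:
  assumes wd: "has_weak_deriv f g" and \<psi>: "circle_fun \<psi>"
    "\<And>x. (\<psi> has_real_derivative \<psi>' x) (at x)" "continuous_on UNIV \<psi>'"
  shows "circle_int (\<lambda>x. f x * \<psi>' x) = - circle_int (\<lambda>x. g x * \<psi> x)"
proof -
  have fL: "f \<in> circle_L1" and gL: "g \<in> circle_L1"
    using wd by (auto simp: has_weak_deriv_def)
  have \<psi>'_per: "circle_fun \<psi>'"
    using \<psi>(1,2) by (rule circle_fun_derivative)
  have \<psi>_cont: "continuous_on UNIV \<psi>"
    using \<psi>(2) by (auto intro!: continuous_at_imp_continuous_on DERIV_isCont)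
  let ?A = "circle_int (\<lambda>x. f x * \<psi>' x) + circle_int (\<lambda>x. g x * \<psi> x)"
  have *: "\<bar>?A\<bar> \<le> e * (2 * (L1_norm f + L1_norm g))" if "e > 0" for e
  proof -
    obtain p where p: "circle_fun p" "\<And>n. C_diff n p" "\<And>x. \<bar>\<psi>' x - p x\<bar> < e"
      using smooth_dense[OF \<psi>'_per \<psi>(3) \<open>e > 0\<close>] by blast
    have p_cont: "continuous_on UNIV p"
      using p(2) C_diff_imp_continuous by blast
    obtain P m where P: "circle_fun P" "\<And>x. (P has_real_derivative p x - \<psi>' x - m) (at x)"
      "\<And>K x. (\<And>y. \<bar>p y - \<psi>' y\<bar> \<le> K) \<Longrightarrow> \<bar>m\<bar> \<le> K \<and> \<bar>P x\<bar> \<le> 2 * K"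
      using circle_antiderivative[of "\<lambda>x. p x - \<psi>' x"] p(1) \<psi>'_per p_cont \<psi>(3)
      by (auto intro!: continuous_intros circle_fun_diff)
    have me: "\<bar>m\<bar> \<le> e" and Pe: "\<bar>P x\<bar> \<le> 2 * e" for x
      using P(3)[of e] p(3) by (auto simp: abs_minus_commute less_imp_le)
    have P_cont: "continuous_on UNIV P"
      using P(2) by (auto intro!: continuous_at_imp_continuous_on DERIV_isCont)
    \<comment> \<open>Adding the periodic antiderivative of \<open>p - \<psi>' - m\<close> replaces
      the derivative of \<open>\<psi>\<close> by the smooth function \<open>p - m\<close>. Hence
      \<open>\<phi>\<close> is smooth, and it differs from \<open>\<psi>\<close> by at most
      \<open>2 * e\<close>.\<close>
    define \<phi> where "\<phi> x = \<psi> x + P x" for x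
    have d\<phi>: "(\<phi> has_real_derivative p x - m) (at x)" for x
      unfolding \<phi>_def using \<psi>(2) P(2) by (auto intro!: derivative_eq_intros)
    have "C_diff n (\<lambda>x. p x - m)" for n
      using C_diff_add[OF p(2) C_diff_const[of n "- m"]] by simp
    then have "C_diff n \<phi>" for n
      using C_diff_Suc_imp[OF C_diff_SucI[OF d\<phi>]] by blast
    moreover have \<phi>_per: "circle_fun \<phi>"
      unfolding \<phi>_def using \<psi>(1) P(1) by (rule circle_fun_add)
    moreover have "deriv \<phi> = (\<lambda>x. p x - m)"
      using d\<phi> by (auto intro: DERIV_imp_deriv)
    ultimately have test: "circle_int (\<lambda>x. f x * (p x - m)) = - circle_int (\<lambda>x. g x * \<phi> x)"
      using wd unfolding has_weak_deriv_def by metis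
    have c: "circle_fun (\<lambda>x. p x - m)" "continuous_on UNIV (\<lambda>x. p x - m)"
      "circle_fun (\<lambda>x. \<psi>' x - (p x - m))" "continuous_on UNIV (\<lambda>x. \<psi>' x - (p x - m))"
      "continuous_on UNIV \<phi>"
      using p(1) p_cont \<psi>'_per \<psi>(3) \<psi>_cont P_cont
      by (auto simp: circle_fun_def \<phi>_def[abs_def] intro!: continuous_intros)
    have "circle_int (\<lambda>x. f x * \<psi>' x) - circle_int (\<lambda>x. f x * (p x - m)) =
        circle_int (\<lambda>x. f x * (\<psi>' x - (p x - m)))"
      using circle_int_diff[OF circle_L1_mult[OF fL \<psi>'_per \<psi>(3)] circle_L1_mult[OF fL c(1,2)]]
      by (simp add: algebra_simps)
    moreover have "circle_int (\<lambda>x. g x * \<phi> x) - circle_int (\<lambda>x. g x * \<psi> x) =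
        circle_int (\<lambda>x. g x * P x)"
      using circle_int_diff[OF circle_L1_mult[OF gL \<phi>_per c(5)] circle_L1_mult[OF gL \<psi>(1) \<psi>_cont]]
      by (simp add: algebra_simps \<phi>_def)
    moreover have "\<bar>circle_int (\<lambda>x. f x * (\<psi>' x - (p x - m)))\<bar> \<le> (2 * e) * L1_norm f"
    proof (rule abs_circle_int_mult_le[OF fL c(3,4)])
      fix x
      show "\<bar>\<psi>' x - (p x - m)\<bar> \<le> 2 * e"
        using p(3)[of x] me by linarith
    qed
    moreover have "\<bar>circle_int (\<lambda>x. g x * P x)\<bar> \<le> (2 * e) * L1_norm g"
      by (rule abs_circle_int_mult_le[OF gL P(1) P_cont Pe])
    ultimately show ?thesis
      using test by (simp add: algebra_simps)
  qed
  have "\<bar>?A\<bar> \<le> 0"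
  proof (rule field_le_epsilon)
    fix e :: real assume "e > 0"
    define K where "K = 2 * (L1_norm f + L1_norm g) + 1"
    have K: "K > 0" using L1_norm_nonneg[of f] L1_norm_nonneg[of g] by (simp add: K_def)
    have "\<bar>?A\<bar> \<le> (e / K) * (K - 1)"
      using *[of "e / K"] \<open>e > 0\<close> K by (simp add: K_def)
    also have "\<dots> \<le> e"
      using K \<open>e > 0\<close> by (simp add: field_simps)
    finally show "\<bar>?A\<bar> \<le> 0 + e" by simp
  qed
  then show ?thesis by simp
qed

text \<open>Introduction rule matching the previous elimination rule: smooth test functions are in
  particular C1, so the calculus of weak derivatives can be carried out with C1 test functions
  throughout.\<close>

lemma has_weak_derivI_C1:
  assumes "f \<in> circle_L1" "g \<in> circle_L1"
    and "\<And>\<psi> \<psi>'. circle_fun \<psi> \<Longrightarrow> (\<And>x. (\<psi> has_real_derivative \<psi>' x) (at x)) \<Longrightarrow>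
      continuous_on UNIV \<psi> \<Longrightarrow> circle_fun \<psi>' \<Longrightarrow> continuous_on UNIV \<psi>' \<Longrightarrow>
      circle_int (\<lambda>x. f x * \<psi>' x) = - circle_int (\<lambda>x. g x * \<psi> x)"
  shows "has_weak_deriv f g"
  unfolding has_weak_deriv_def
proof (intro conjI allI impI assms(1,2); elim conjE)
  fix \<phi> assume \<phi>: "circle_fun \<phi>" "\<forall>n. C_diff n \<phi>"
  have 1: "(\<phi> has_real_derivative deriv \<phi> x) (at x)" for x
    using \<phi>(2) C_diff_has_derivative by blast
  have "continuous_on UNIV \<phi>" "continuous_on UNIV (deriv \<phi>)"
    using \<phi>(2)[rule_format, of 0] \<phi>(2)[rule_format, of 1] by (auto simp: C_diff_def)
  moreover have "circle_fun (deriv \<phi>)"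
    using \<phi>(1) 1 by (rule circle_fun_derivative)
  ultimately show "circle_int (\<lambda>x. f x * deriv \<phi> x) = - circle_int (\<lambda>x. g x * \<phi> x)"
    using \<phi>(1) 1 by (intro assms(3))
qed

lemma has_weak_deriv_L1:
  "has_weak_deriv f g \<Longrightarrow> f \<in> circle_L1" "has_weak_deriv f g \<Longrightarrow> g \<in> circle_L1"
  by (auto simp: has_weak_deriv_def)

section \<open>Calculus rules for weak derivatives\<close>

lemma has_weak_deriv_add:
  assumes "has_weak_deriv f f'" "has_weak_deriv g g'"
  shows "has_weak_deriv (\<lambda>x. f x + g x) (\<lambda>x. f' x + g' x)"
proof (rule has_weak_derivI_C1)
  fix \<psi> \<psi>' assume \<psi>: "circle_fun \<psi>" "\<And>x. (\<psi> has_real_derivative \<psi>' x) (at x)"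
    "continuous_on UNIV \<psi>" "circle_fun \<psi>'" "continuous_on UNIV \<psi>'"
  have "circle_int (\<lambda>x. (f x + g x) * \<psi>' x) =
      circle_int (\<lambda>x. f x * \<psi>' x) + circle_int (\<lambda>x. g x * \<psi>' x)"
    using circle_int_add[OF circle_L1_mult circle_L1_mult] assms \<psi>
    by (simp add: distrib_right has_weak_deriv_L1)
  also have "\<dots> = - (circle_int (\<lambda>x. f' x * \<psi> x) + circle_int (\<lambda>x. g' x * \<psi> x))"
    using has_weak_deriv_C1[OF assms(1) \<psi>(1,2,5)] has_weak_deriv_C1[OF assms(2) \<psi>(1,2,5)] by simp
  also have "circle_int (\<lambda>x. f' x * \<psi> x) + circle_int (\<lambda>x. g' x * \<psi> x) =
      circle_int (\<lambda>x. (f' x + g' x) * \<psi> x)"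
    using circle_int_add[OF circle_L1_mult circle_L1_mult] assms \<psi>
    by (simp add: distrib_right has_weak_deriv_L1)
  finally show "circle_int (\<lambda>x. (f x + g x) * \<psi>' x) = - circle_int (\<lambda>x. (f' x + g' x) * \<psi> x)" .
qed (use assms in \<open>auto intro: circle_L1_add has_weak_deriv_L1\<close>)

text \<open>The weight is moved to the test function: \<open>f\<close> is tested against the
  derivative of \<open>w x * \<psi> x\<close>, which the classical product rule expands.\<close>

lemma has_weak_deriv_mult:
  assumes wd: "has_weak_deriv f f'" and w: "circle_fun w" "circle_fun w'"
    "\<And>x. (w has_real_derivative w' x) (at x)" "continuous_on UNIV w'"
  shows "has_weak_deriv (\<lambda>x. f x * w x) (\<lambda>x. f' x * w x + f x * w' x)"
proof -
  have w_cont: "continuous_on UNIV w"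
    using w(3) by (auto intro!: continuous_at_imp_continuous_on DERIV_isCont)
  note L = has_weak_deriv_L1[OF wd]
  note M = circle_L1_mult[OF L(1) w(1) w_cont] circle_L1_mult[OF L(2) w(1) w_cont]
    circle_L1_mult[OF L(1) w(2,4)]
  show ?thesis
  proof (rule has_weak_derivI_C1)
    fix \<psi> \<psi>' assume \<psi>: "circle_fun \<psi>" "\<And>x. (\<psi> has_real_derivative \<psi>' x) (at x)"
      "continuous_on UNIV \<psi>" "circle_fun \<psi>'" "continuous_on UNIV \<psi>'"
    have "circle_int (\<lambda>x. f x * (w x * \<psi>' x + w' x * \<psi> x)) = - circle_int (\<lambda>x. f' x * (w x * \<psi> x))"
    proof (rule has_weak_deriv_C1[OF wd])
      show "((\<lambda>x. w x * \<psi> x) has_real_derivative w x * \<psi>' x + w' x * \<psi> x) (at x)" for x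
        using w(3) \<psi>(2) by (auto intro!: derivative_eq_intros)
    qed (use w \<psi> w_cont in \<open>auto intro!: circle_fun_mult continuous_intros\<close>)
    moreover have "circle_int (\<lambda>x. f x * (w x * \<psi>' x + w' x * \<psi> x)) =
        circle_int (\<lambda>x. f x * w x * \<psi>' x) + circle_int (\<lambda>x. f x * w' x * \<psi> x)"
      using circle_int_add[OF circle_L1_mult[OF M(1) \<psi>(4,5)] circle_L1_mult[OF M(3) \<psi>(1,3)]]
      by (simp add: algebra_simps)
    moreover have "circle_int (\<lambda>x. (f' x * w x + f x * w' x) * \<psi> x) =
        circle_int (\<lambda>x. f' x * w x * \<psi> x) + circle_int (\<lambda>x. f x * w' x * \<psi> x)"
      using circle_int_add[OF circle_L1_mult[OF M(2) \<psi>(1,3)] circle_L1_mult[OF M(3) \<psi>(1,3)]]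
      by (simp add: algebra_simps)
    ultimately show "circle_int (\<lambda>x. f x * w x * \<psi>' x) =
        - circle_int (\<lambda>x. (f' x * w x + f x * w' x) * \<psi> x)"
      by (simp add: mult.assoc)
  qed (use M in \<open>auto intro: circle_L1_add\<close>)
qed

lemma has_weak_deriv_cmult:
  "has_weak_deriv f f' \<Longrightarrow> has_weak_deriv (\<lambda>x. c * f x) (\<lambda>x. c * f' x)"
  using has_weak_deriv_mult[of f f' "\<lambda>_. c" "\<lambda>_. 0"]
  by (simp add: circle_fun_def mult.commute)

lemma has_weak_deriv_diff:
  assumes "has_weak_deriv f f'" "has_weak_deriv g g'"
  shows "has_weak_deriv (\<lambda>x. f x - g x) (\<lambda>x. f' x - g' x)"
  using has_weak_deriv_add[OF assms(1) has_weak_deriv_cmult[OF assms(2), of "- 1"]] by simp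

lemma has_weak_deriv_shift:
  assumes wd: "has_weak_deriv f f'"
  shows "has_weak_deriv (\<lambda>x. f (x + c)) (\<lambda>x. f' (x + c))"
proof (rule has_weak_derivI_C1)
  fix \<psi> \<psi>' assume \<psi>: "circle_fun \<psi>" "\<And>x. (\<psi> has_real_derivative \<psi>' x) (at x)"
    "continuous_on UNIV \<psi>" "circle_fun \<psi>'" "continuous_on UNIV \<psi>'"
  have per: "circle_fun (\<lambda>x. u (x - c))" if "circle_fun u" for u
    using circle_fun_shift[OF that, of "- c"] by simp
  have cont: "continuous_on UNIV (\<lambda>x. u (x - c))" if "continuous_on UNIV u" for u :: "real \<Rightarrow> real"
    by (intro continuous_on_compose2[OF that] continuous_intros) auto
  have d: "((\<lambda>x. \<psi> (x - c)) has_real_derivative \<psi>' (x - c)) (at x)" for x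
    using \<psi>(2) DERIV_shift[of \<psi> "\<psi>' (x - c)" x "- c"] by simp
  have "circle_int (\<lambda>x. f (x + c) * \<psi>' x) = circle_int (\<lambda>x. f x * \<psi>' (x - c))"
    using circle_shift(2)[OF circle_L1_mult[OF has_weak_deriv_L1(1)[OF wd] per[of \<psi>'] cont[of \<psi>']], where c=c] \<psi>
    by simp
  also have "\<dots> = - circle_int (\<lambda>x. f' x * \<psi> (x - c))"
    by (rule has_weak_deriv_C1[OF wd per[OF \<psi>(1)] d cont[OF \<psi>(5)]])
  also have "circle_int (\<lambda>x. f' x * \<psi> (x - c)) = circle_int (\<lambda>x. f' (x + c) * \<psi> x)"
    using circle_shift(2)[OF circle_L1_mult[OF has_weak_deriv_L1(2)[OF wd] per[of \<psi>] cont[of \<psi>]], where c=c] \<psi>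
    by simp
  finally show "circle_int (\<lambda>x. f (x + c) * \<psi>' x) = - circle_int (\<lambda>x. f' (x + c) * \<psi> x)" .
qed (use wd in \<open>auto intro: circle_shift has_weak_deriv_L1\<close>)

text \<open>Moves a weak derivative across an equality that holds only almost everywhere. The
  equality is expressed as zero L1 distance, the form in which uniqueness of weak derivatives also
  delivers it.\<close>

lemma has_weak_deriv_cong:
  assumes wd: "has_weak_deriv f f'" and g: "g \<in> circle_L1" "L1_norm (\<lambda>x. f x - g x) = 0"
  shows "has_weak_deriv g f'"
proof (rule has_weak_derivI_C1)
  note L = has_weak_deriv_L1[OF wd]
  fix \<psi> \<psi>' assume \<psi>: "circle_fun \<psi>" "\<And>x. (\<psi> has_real_derivative \<psi>' x) (at x)"
    "continuous_on UNIV \<psi>" "circle_fun \<psi>'" "continuous_on UNIV \<psi>'"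
  obtain K where "\<And>x. \<bar>\<psi>' x\<bar> \<le> K"
    using circle_fun_bounded[OF \<psi>(4,5)] by blast
  then have "circle_int (\<lambda>x. (f x - g x) * \<psi>' x) = 0"
    using abs_circle_int_mult_le[OF circle_L1_diff[OF L(1) g(1)] \<psi>(4,5)] g(2) by fastforce
  then have "circle_int (\<lambda>x. g x * \<psi>' x) = circle_int (\<lambda>x. f x * \<psi>' x)"
    using circle_int_diff[OF circle_L1_mult[OF L(1) \<psi>(4,5)] circle_L1_mult[OF g(1) \<psi>(4,5)]]
    by (simp add: left_diff_distrib)
  then show "circle_int (\<lambda>x. g x * \<psi>' x) = - circle_int (\<lambda>x. f' x * \<psi> x)"
    using has_weak_deriv_C1[OF wd \<psi>(1,2,5)] by simp
qed (use g has_weak_deriv_L1[OF wd] in auto)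

section \<open>Norm estimates through weak derivatives\<close>

text \<open>The difference of two weak derivatives of \<open>f\<close> annihilates every smooth test
  function, hence by uniform density every continuous one, so the two have the same pairings and, by
  duality, the same norm.\<close>

lemma L1_norm_weak_deriv_unique:
  assumes "has_weak_deriv f g" "has_weak_deriv f g'"
  shows "L1_norm g = L1_norm g'"
proof -
  have "L1_norm g \<le> L1_norm g'" if g: "has_weak_deriv f g" and g': "has_weak_deriv f g'" for g g'
  proof (rule L1_norm_le_dual)
    fix \<psi> :: "real \<Rightarrow> real"
    assume \<psi>: "circle_fun \<psi>" "continuous_on UNIV \<psi>" "\<And>x. \<bar>\<psi> x\<bar> \<le> 1"
    note L = has_weak_deriv_L1(2)[OF g] has_weak_deriv_L1(2)[OF g']
    let ?d = "\<lambda>x. g x - g' x"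
    have d: "has_weak_deriv (\<lambda>x. 0) ?d"
      using has_weak_deriv_diff[OF g g'] by simp
    have *: "\<bar>circle_int (\<lambda>x. ?d x * \<psi> x)\<bar> \<le> e * L1_norm ?d" if "e > 0" for e
    proof -
      obtain p where p: "circle_fun p" "\<And>n. C_diff n p" "\<And>x. \<bar>\<psi> x - p x\<bar> < e"
        using smooth_dense[OF \<psi>(1,2) \<open>e > 0\<close>] by blast
      have pc: "continuous_on UNIV p"
        using p(2) C_diff_imp_continuous by blast
      have "circle_int (\<lambda>x. ?d x * p x) = 0"
        using d p(1,2) by (simp add: has_weak_deriv_def) (auto simp: circle_int_eq)
      then have "circle_int (\<lambda>x. ?d x * \<psi> x) = circle_int (\<lambda>x. ?d x * (\<psi> x - p x))"
        using circle_int_diff[OF circle_L1_mult[OF circle_L1_diff[OF L] \<psi>(1,2)]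
            circle_L1_mult[OF circle_L1_diff[OF L] p(1) pc]]
        by (simp add: right_diff_distrib)
      also have "\<bar>\<dots>\<bar> \<le> e * L1_norm ?d"
        using \<psi> p pc L by (intro abs_circle_int_mult_le circle_L1_diff circle_fun_diff continuous_intros)
          (auto intro: less_imp_le)
      finally show ?thesis .
    qed
    have "\<bar>circle_int (\<lambda>x. ?d x * \<psi> x)\<bar> \<le> 0"
    proof (rule field_le_epsilon)
      fix e :: real assume "e > 0"
      have "L1_norm ?d + 1 > 0" using L1_norm_nonneg[of ?d] by linarith
      with \<open>e > 0\<close> have "\<bar>circle_int (\<lambda>x. ?d x * \<psi> x)\<bar> \<le> e / (L1_norm ?d + 1) * L1_norm ?d"
        by (intro *) simp
      also have "\<dots> \<le> e"
        using \<open>e > 0\<close> \<open>L1_norm ?d + 1 > 0\<close> by (simp add: field_simps)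
      finally show "\<bar>circle_int (\<lambda>x. ?d x * \<psi> x)\<bar> \<le> 0 + e" by simp
    qed
    then have "circle_int (\<lambda>x. g x * \<psi> x) = circle_int (\<lambda>x. g' x * \<psi> x)"
      using circle_int_diff[OF circle_L1_mult[OF L(1) \<psi>(1,2)] circle_L1_mult[OF L(2) \<psi>(1,2)]]
      by (simp add: left_diff_distrib)
    also have "\<dots> \<le> 1 * L1_norm g'"
      using abs_circle_int_mult_le[OF L(2) \<psi>] by linarith
    finally show "circle_int (\<lambda>x. g x * \<psi> x) \<le> L1_norm g'" by simp
  qed (use has_weak_deriv_L1 g in auto)
  from this[OF assms] this[OF assms(2,1)] show ?thesis by (rule order_antisym)
qed

text \<open>Frees the norm from the choice made in \<open>weak_deriv\<close>: any weak derivative at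
  hand may be used to compute it.\<close>

lemma W1_norm_1_eq:
  assumes "has_weak_deriv f g"
  shows "W1_norm 1 f = ennreal (L1_norm f + L1_norm g)"
proof -
  have "f \<in> W1 1"
    unfolding One_nat_def W1.simps using assms has_weak_deriv_L1(2)[OF assms] by blast
  moreover have "has_weak_deriv f (weak_deriv f)"
    unfolding weak_deriv_def by (rule someI[of "has_weak_deriv f", OF assms])
  then have "L1_norm (weak_deriv f) = L1_norm g"
    using assms L1_norm_weak_deriv_unique by blast
  ultimately show ?thesis by (simp add: W1_norm_def)
qed

text \<open>By duality. Since \<open>f\<close> has mean zero, \<open>\<psi>\<close> may be replaced
  by \<open>\<psi> - m\<close>, the derivative of a periodic \<open>P\<close> bounded by 2;
  integrating by parts moves the derivative to \<open>f\<close>. The constant 2 is the bound on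
  \<open>P\<close>.\<close>

lemma poincare:
  assumes wd: "has_weak_deriv f g" and mean: "circle_int f = 0"
  shows "L1_norm f \<le> 2 * L1_norm g"
proof (rule L1_norm_le_dual)
  note L = has_weak_deriv_L1[OF wd]
  show "f \<in> circle_L1" by (rule L)
  fix \<psi> :: "real \<Rightarrow> real"
  assume \<psi>: "circle_fun \<psi>" "continuous_on UNIV \<psi>" "\<And>x. \<bar>\<psi> x\<bar> \<le> 1"
  obtain P m where P: "circle_fun P" "\<And>x. (P has_real_derivative \<psi> x - m) (at x)"
    "\<And>K x. (\<And>y. \<bar>\<psi> y\<bar> \<le> K) \<Longrightarrow> \<bar>m\<bar> \<le> K \<and> \<bar>P x\<bar> \<le> 2 * K"
    using circle_antiderivative[OF \<psi>(1,2)] by blast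
  have Pc: "continuous_on UNIV P"
    using P(2) by (auto intro!: continuous_at_imp_continuous_on DERIV_isCont)
  have "circle_int (\<lambda>x. f x * \<psi> x) = circle_int (\<lambda>x. f x * (\<psi> x - m))"
    using circle_int_diff[OF circle_L1_mult[OF L(1) \<psi>(1,2)] circle_L1_cmult[OF L(1), of m]] mean
    by (simp add: algebra_simps circle_int_cmult)
  also have "\<dots> = - circle_int (\<lambda>x. g x * P x)"
    using \<psi> P by (intro has_weak_deriv_C1[OF wd] continuous_intros)
  also have "\<dots> \<le> 2 * L1_norm g"
    using abs_circle_int_mult_le[OF L(2) P(1) Pc, of 2] P(3)[OF \<psi>(3)] by auto
  finally show "circle_int (\<lambda>x. f x * \<psi> x) \<le> 2 * L1_norm g" .
qed

lemma L1_norm_shift: "f \<in> circle_L1 \<Longrightarrow> L1_norm (\<lambda>x. f (x + c)) = L1_norm f"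
  using circle_shift(2)[of "\<lambda>x. \<bar>f x\<bar>"] circle_L1_abs by auto

text \<open>Dual form of the mean value estimate: moving the translations to the test function
  leaves \<open>\<psi> (x - a) - \<psi> (x - b)\<close>, which is the derivative of a periodic
  function bounded by the distance of \<open>a\<close> and \<open>b\<close>.\<close>

lemma L1_norm_shift_diff_le:
  assumes wd: "has_weak_deriv f g"
  shows "L1_norm (\<lambda>x. f (x + a) - f (x + b)) \<le> \<bar>a - b\<bar> * L1_norm g"
proof (rule L1_norm_le_dual)
  note L = has_weak_deriv_L1[OF wd]
  show "(\<lambda>x. f (x + a) - f (x + b)) \<in> circle_L1"
    by (rule circle_L1_diff[OF circle_shift(1)[OF L(1)] circle_shift(1)[OF L(1)]])
  fix \<psi> :: "real \<Rightarrow> real"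
  assume \<psi>: "circle_fun \<psi>" "continuous_on UNIV \<psi>" "\<And>x. \<bar>\<psi> x\<bar> \<le> 1"
  obtain P m where P: "circle_fun P" "\<And>x. (P has_real_derivative \<psi> x - m) (at x)"
    by (rule circle_antiderivative[OF \<psi>(1,2)]) (rule that)
  have per: "circle_fun (\<lambda>x. u (x - c))" if "circle_fun u" for u c
    using circle_fun_shift[OF that, of "- c"] by simp
  have cont: "continuous_on UNIV (\<lambda>x. u (x - c))" if "continuous_on UNIV u" for u :: "real \<Rightarrow> real" and c
    by (intro continuous_on_compose2[OF that] continuous_intros) auto
  \<comment> \<open>This is the integral of \<open>\<psi>\<close> from \<open>x - b\<close> to
    \<open>x - a\<close>; the constant \<open>m * (b - a)\<close> restores the mean that was removed
    from \<open>\<psi>\<close> in \<open>P\<close>.\<close>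
  define \<Psi> where "\<Psi> x = P (x - a) - P (x - b) + m * (b - a)" for x
  have d: "(\<Psi> has_real_derivative \<psi> (x - a) - \<psi> (x - b)) (at x)" for x
  proof -
    have 1: "((\<lambda>x. P (x - c)) has_real_derivative \<psi> (x - c) - m) (at x)" for c
      using P(2)[of "x - c"] DERIV_shift[of P "\<psi> (x - c) - m" x "- c"] by simp
    then show ?thesis
      unfolding \<Psi>_def by (auto intro!: derivative_eq_intros 1)
  qed
  have \<Psi>_per: "circle_fun \<Psi>"
    using per[OF P(1), of a] per[OF P(1), of b] by (simp add: \<Psi>_def circle_fun_def)
  have \<Psi>_cont: "continuous_on UNIV \<Psi>"
    using d by (auto intro!: continuous_at_imp_continuous_on DERIV_isCont)
  have \<Psi>: "\<bar>\<Psi> x\<bar> \<le> \<bar>a - b\<bar>" for x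
  proof -
    have "((\<lambda>y. P y + m * y) has_real_derivative \<psi> y) (at y)" for y
      using P(2) by (auto intro!: derivative_eq_intros)
    then have "norm ((P (x - a) + m * (x - a)) - (P (x - b) + m * (x - b)))
        \<le> 1 * norm ((x - a) - (x - b))"
      by (intro field_differentiable_bound[of UNIV]) (use \<psi>(3) in auto)
    then show ?thesis by (simp add: \<Psi>_def algebra_simps abs_minus_commute)
  qed
  have S: "(\<lambda>x. f x * \<psi> (x - c)) \<in> circle_L1"
      "circle_int (\<lambda>x. f (x + c) * \<psi> x) = circle_int (\<lambda>x. f x * \<psi> (x - c))" for c
  proof -
    show *: "(\<lambda>x. f x * \<psi> (x - c)) \<in> circle_L1"
      by (rule circle_L1_mult[OF L(1) per[OF \<psi>(1)] cont[OF \<psi>(2)]])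
    show "circle_int (\<lambda>x. f (x + c) * \<psi> x) = circle_int (\<lambda>x. f x * \<psi> (x - c))"
      using circle_shift(2)[OF *, of c] by simp
  qed
  have "circle_int (\<lambda>x. (f (x + a) - f (x + b)) * \<psi> x) =
      circle_int (\<lambda>x. f (x + a) * \<psi> x) - circle_int (\<lambda>x. f (x + b) * \<psi> x)"
    using circle_int_diff[OF circle_L1_mult[OF circle_shift(1)[OF L(1)] \<psi>(1,2)]
        circle_L1_mult[OF circle_shift(1)[OF L(1)] \<psi>(1,2)]]
    by (simp add: left_diff_distrib)
  also have "\<dots> = circle_int (\<lambda>x. f x * (\<psi> (x - a) - \<psi> (x - b)))"
    using circle_int_diff[OF S(1) S(1)] by (simp add: S(2) right_diff_distrib)
  also have "\<dots> = - circle_int (\<lambda>x. g x * \<Psi> x)"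
    by (rule has_weak_deriv_C1[OF wd \<Psi>_per d continuous_on_diff[OF cont[OF \<psi>(2)] cont[OF \<psi>(2)]]])
  also have "\<dots> \<le> \<bar>a - b\<bar> * L1_norm g"
    using abs_circle_int_mult_le[OF L(2) \<Psi>_per \<Psi>_cont \<Psi>] by linarith
  finally show "circle_int (\<lambda>x. (f (x + a) - f (x + b)) * \<psi> x) \<le> \<bar>a - b\<bar> * L1_norm g" .
qed

section \<open>The transfer operator of a covering map\<close>

text \<open>An orientation preserving C1 covering of the circle of degree \<open>d\<close>, given by
  a lift.\<close>

locale circle_cover =
  fixes F F' :: "real \<Rightarrow> real" and d :: nat
  assumes deg: "F (x + 1) = F x + real d"
    and has_deriv: "(F has_real_derivative F' x) (at x)"
    and deriv_pos: "F' x > 0"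
    and deriv_cont: "continuous_on UNIV F'"
begin

lemma strict_mono_F: "strict_mono F"
  by (rule strict_monoI) (meson DERIV_pos_imp_increasing has_deriv deriv_pos)

lemma continuous_F: "continuous_on UNIV F"
  using has_deriv by (auto intro!: continuous_at_imp_continuous_on DERIV_isCont)

lemma deriv_F: "deriv F = F'"
  using has_deriv by (auto intro: DERIV_imp_deriv)

lemma image_F: "F ` {0..<1} = {F 0..<F 0 + real d}"
proof (intro subset_antisym subsetI)
  fix z assume z: "z \<in> {F 0..<F 0 + real d}"
  then have "F 0 \<le> z" "z \<le> F 1" using deg[of 0] by auto
  then obtain y where y: "0 \<le> y" "y \<le> 1" "F y = z"
    using IVT'[of F 0 z 1] continuous_F by (auto intro: continuous_on_subset)
  moreover have "y \<noteq> 1" using y(3) z deg[of 0] by auto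
  ultimately show "z \<in> F ` {0..<1}" by force
next
  fix z assume "z \<in> F ` {0..<1}"
  then obtain y where "z = F y" "0 \<le> y" "y < 1" by auto
  then show "z \<in> {F 0..<F 0 + real d}"
    using strict_mono_F deg[of 0] by (auto simp: strict_mono_less_eq dest: strict_monoD[of F y 1])
qed

lemma inj_F: "inj_on F S"
  using strict_mono_F strict_mono_imp_inj_on inj_on_subset by blast

text \<open>All \<open>d\<close> inverse branches at once: the lift maps [0,1) bijectively onto an
  interval of length \<open>d\<close>, and each unit piece of that interval carries one
  branch.\<close>

definition G :: "real \<Rightarrow> real" where
  "G = inv_into {0..<1} F"

lemma G_F: "0 \<le> y \<Longrightarrow> y < 1 \<Longrightarrow> G (F y) = y"
  by (simp add: G_def inj_F inv_into_f_f)

lemma F_G: "F 0 \<le> z \<Longrightarrow> z < F 0 + real d \<Longrightarrow> F (G z) = z"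
  and G_range: "F 0 \<le> z \<Longrightarrow> z < F 0 + real d \<Longrightarrow> G z \<in> {0..<1}"
  using f_inv_into_f[of z F "{0..<1}"] inv_into_into[of z F "{0..<1}"]
  by (auto simp: G_def image_F)

text \<open>For \<open>x\<close> in the window starting at \<open>F 0\<close>, the integer
  translates of \<open>x\<close> lying in the image of [0,1) are exactly \<open>x + real j\<close>
  with \<open>j < d\<close>, so the preimages are indexed by \<open>j\<close>.\<close>

lemma transfer_op_eq:
  assumes x: "F 0 \<le> x" "x < F 0 + 1"
  shows "transfer_op F f x = (\<Sum>j<d. f (G (x + real j)) / F' (G (x + real j)))"
proof -
  have dom: "F 0 \<le> x + real j" "x + real j < F 0 + real d" if "j < d" for j
  proof -
    have "real j + 1 \<le> real d" using that by linarith
    then show "F 0 \<le> x + real j" "x + real j < F 0 + real d" using x by auto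
  qed
  have preimages: "{y\<in>{0..<1}. F y - x \<in> \<int>} = (\<lambda>j. G (x + real j)) ` {..<d}"
  proof (intro subset_antisym subsetI)
    fix y assume "y \<in> {y\<in>{0..<1}. F y - x \<in> \<int>}"
    then obtain i where y: "0 \<le> y" "y < 1" "F y - x = of_int i"
      by (auto elim: Ints_cases)
    then have "F y \<in> {F 0..<F 0 + real d}" using image_F by force
    with x y(3) have "real_of_int i > -1" "real_of_int i < real d" by auto
    then have "0 \<le> i" "nat i < d" by linarith+
    moreover from this have "F y = x + real (nat i)" using y(3) by simp
    ultimately show "y \<in> (\<lambda>j. G (x + real j)) ` {..<d}"
      using G_F[OF y(1,2)] by (auto intro!: image_eqI[of _ _ "nat i"])
  next
    fix y assume "y \<in> (\<lambda>j. G (x + real j)) ` {..<d}"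
    then obtain j where j: "j < d" "y = G (x + real j)" by auto
    then show "y \<in> {y\<in>{0..<1}. F y - x \<in> \<int>}"
      using F_G[OF dom[OF j(1)]] G_range[OF dom[OF j(1)]] by simp
  qed
  have inj: "inj_on (\<lambda>j. G (x + real j)) {..<d}"
  proof (rule inj_onI)
    fix i j assume "i \<in> {..<d}" "j \<in> {..<d}" and eq: "G (x + real i) = G (x + real j)"
    then have ij: "i < d" "j < d" by auto
    have "F (G (x + real i)) = x + real i" "F (G (x + real j)) = x + real j"
      by (rule F_G[OF dom[OF ij(1)]], rule F_G[OF dom[OF ij(2)]])
    with eq have "x + real i = x + real j" by metis
    then show "i = j" by simp
  qed
  have "\<bar>F' y\<bar> = F' y" for y
    using deriv_pos[of y] by simp
  then show ?thesis
    unfolding transfer_op_def preimages sum.reindex[OF inj] by (simp add: deriv_F)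
qed

lemma circle_fun_transfer_op: "circle_fun (transfer_op F f)"
proof -
  have "F y - (x + 1) \<in> \<int> \<longleftrightarrow> F y - x \<in> \<int>" for x y
    using Ints_add[of "F y - (x + 1)" 1] Ints_diff[of "F y - x" 1] by (auto simp: algebra_simps)
  then show ?thesis by (simp add: circle_fun_def transfer_op_def)
qed

lemma circle_fun_comp_F: "circle_fun \<phi> \<Longrightarrow> circle_fun (\<lambda>x. \<phi> (F x))"
  using circle_fun_of_int[of \<phi> _ "int d"] by (simp add: circle_fun_def deg)

lemma continuous_comp_F: "continuous_on UNIV \<phi> \<Longrightarrow> continuous_on UNIV (\<lambda>x. \<phi> (F x))"
  by (rule continuous_on_compose2[OF _ continuous_F]) auto

text \<open>Substituting along \<open>F\<close> turns the right-hand integral into one over an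
  interval of length \<open>d\<close>. Cutting it into \<open>d\<close> unit pieces and translating
  them all to the first one produces the sum over preimages.\<close>

lemma transfer_op_integral:
  assumes f: "f \<in> circle_L1" and \<phi>: "circle_fun \<phi>" "continuous_on UNIV \<phi>"
  shows "(\<lambda>x. transfer_op F f x * \<phi> x) absolutely_integrable_on {F 0..<F 0 + 1}"
    and "integral {F 0..<F 0 + 1} (\<lambda>x. transfer_op F f x * \<phi> x) = circle_int (\<lambda>x. f x * \<phi> (F x))"
proof -
  \<comment> \<open>The integrand after substitution; dividing by \<open>F'\<close> compensates the
    Jacobian.\<close>
  define v where "v z = f (G z) / F' (G z) * \<phi> z" for z
  let ?I = "circle_int (\<lambda>x. f x * \<phi> (F x))"
  have L: "(\<lambda>x. f x * \<phi> (F x)) \<in> circle_L1"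
    by (intro circle_L1_mult f circle_fun_comp_F continuous_comp_F \<phi>)
  have eq: "\<bar>F' x\<bar> * v (F x) = f x * \<phi> (F x)" if "x \<in> {0..<1}" for x
    using that deriv_pos[of x] by (simp add: v_def G_F)
  have "(\<lambda>x. \<bar>F' x\<bar> * v (F x)) absolutely_integrable_on {0..<1}"
    using L eq by (subst set_integrable_cong[OF refl refl eq]) (auto simp: circle_L1_def)
  moreover have "integral {0..<1} (\<lambda>x. \<bar>F' x\<bar> * v (F x)) = ?I"
    using circle_int_period[OF L, of 0]
      Henstock_Kurzweil_Integration.integral_cong[of "{0..<1}", OF eq] by simp
  ultimately have "v absolutely_integrable_on F ` {0..<1} \<and> integral (F ` {0..<1}) v = ?I"
    by (subst has_absolute_integral_change_of_variables_1'[symmetric, where g' = F'])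
      (auto intro: inj_F has_field_derivative_at_within has_deriv)
  then have v: "v absolutely_integrable_on {F 0..<F 0 + real d}" "integral {F 0..<F 0 + real d} v = ?I"
    by (simp_all add: image_F)
  have pieces: "integral {F 0..<F 0 + real n} v = (\<Sum>j<n. integral {F 0 + real j..<F 0 + real j + 1} v)"
    if "n \<le> d" for n
    using that
  proof (induction n)
    case (Suc n)
    have "v absolutely_integrable_on {F 0..<F 0 + real (Suc n)}"
      using Suc.prems by (intro set_integrable_subset[OF v(1)]) auto
    then have "integral {F 0..<F 0 + real (Suc n)} v =
        integral {F 0..<F 0 + real n} v + integral {F 0 + real n..<F 0 + real (Suc n)} v"
      by (intro absolutely_integrable_Un_ivl(2)) auto
    then show ?case using Suc by (simp add: algebra_simps)
  qed simp
  have piece: "(\<lambda>x. v (x + real j)) absolutely_integrable_on {F 0..<F 0 + 1}"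
    "integral {F 0..<F 0 + 1} (\<lambda>x. v (x + real j)) = integral {F 0 + real j..<F 0 + real j + 1} v"
    if "j < d" for j
  proof -
    have "real j + 1 \<le> real d" using that by linarith
    then have "v absolutely_integrable_on {F 0 + real j..<F 0 + 1 + real j}"
      by (intro set_integrable_subset[OF v(1)]) auto
    then show "(\<lambda>x. v (x + real j)) absolutely_integrable_on {F 0..<F 0 + 1}"
      "integral {F 0..<F 0 + 1} (\<lambda>x. v (x + real j)) = integral {F 0 + real j..<F 0 + real j + 1} v"
      using absolutely_integrable_shift[where f = v and c = "real j" and a = "F 0" and b = "F 0 + 1"
          and I = "integral {F 0 + real j..<F 0 + 1 + real j} v"]
      by (auto simp: algebra_simps)
  qed
  have sum: "transfer_op F f x * \<phi> x = (\<Sum>j<d. v (x + real j))" if "x \<in> {F 0..<F 0 + 1}" for x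
  proof -
    have "\<phi> (x + real j) = \<phi> x" for j
      using circle_fun_of_int[OF \<phi>(1), of x "int j"] by simp
    with that show ?thesis by (simp add: transfer_op_eq v_def sum_distrib_right)
  qed
  show "(\<lambda>x. transfer_op F f x * \<phi> x) absolutely_integrable_on {F 0..<F 0 + 1}"
    by (subst set_integrable_cong[OF refl refl sum])
      (auto intro: absolutely_integrable_sum[OF finite_lessThan] piece(1))
  have "integral {F 0..<F 0 + 1} (\<lambda>x. transfer_op F f x * \<phi> x) =
      integral {F 0..<F 0 + 1} (\<lambda>x. \<Sum>j<d. v (x + real j))"
    by (rule Henstock_Kurzweil_Integration.integral_cong) (rule sum)
  also have "\<dots> = (\<Sum>j<d. integral {F 0..<F 0 + 1} (\<lambda>x. v (x + real j)))"
    using piece(1)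
    by (intro Henstock_Kurzweil_Integration.integral_sum) (auto dest: set_lebesgue_integral_eq_integral(1))
  also have "\<dots> = ?I"
    using pieces[of d] piece(2) v(2) by simp
  finally show "integral {F 0..<F 0 + 1} (\<lambda>x. transfer_op F f x * \<phi> x) = ?I" .
qed

lemma transfer_op_L1:
  assumes "f \<in> circle_L1"
  shows "transfer_op F f \<in> circle_L1"
proof -
  have "circle_fun (\<lambda>_. 1)" by (simp add: circle_fun_def)
  from transfer_op_integral(1)[OF assms this continuous_on_const]
  have "transfer_op F f absolutely_integrable_on {F 0..<F 0 + 1}" by simp
  then show ?thesis
    unfolding circle_L1_period[of _ "F 0"] using circle_fun_transfer_op by blast
qed

lemma transfer_op_dual:
  assumes "f \<in> circle_L1" "circle_fun \<phi>" "continuous_on UNIV \<phi>"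
  shows "circle_int (\<lambda>x. transfer_op F f x * \<phi> x) = circle_int (\<lambda>x. f x * \<phi> (F x))"
  using circle_int_period[OF circle_L1_mult[OF transfer_op_L1[OF assms(1)] assms(2,3)]]
    transfer_op_integral(2)[OF assms] by (rule trans)

lemma circle_int_transfer_op: "f \<in> circle_L1 \<Longrightarrow> circle_int (transfer_op F f) = circle_int f"
  using transfer_op_dual[of f "\<lambda>_. 1"] by (simp add: circle_fun_def)

text \<open>Positivity gives a pointwise bound by the transfer of the absolute value, whose integral
  is preserved.\<close>

lemma L1_norm_transfer_op_le:
  assumes "f \<in> circle_L1"
  shows "L1_norm (transfer_op F f) \<le> L1_norm f"
proof -
  have "\<bar>transfer_op F f x\<bar> \<le> transfer_op F (\<lambda>x. \<bar>f x\<bar>) x" for x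
    unfolding transfer_op_def by (rule order_trans[OF sum_abs]) simp
  then have "L1_norm (transfer_op F f) \<le> circle_int (transfer_op F (\<lambda>x. \<bar>f x\<bar>))"
    using assms by (intro circle_int_mono circle_L1_abs transfer_op_L1)
  then show ?thesis
    using assms by (simp add: circle_int_transfer_op circle_L1_abs)
qed

lemma transfer_op_diff: "transfer_op F (\<lambda>x. f x - g x) x = transfer_op F f x - transfer_op F g x"
  by (simp add: transfer_op_def diff_divide_distrib sum_subtractf)

lemma circle_fun_F': "circle_fun F'"
proof -
  have "((\<lambda>y. F (y + 1)) has_real_derivative F' (x + 1)) (at x)" for x
    using has_deriv by (simp add: DERIV_shift[symmetric])
  moreover have "((\<lambda>y. F (y + 1)) has_real_derivative F' x) (at x)" for x
    unfolding deg by (auto intro!: derivative_eq_intros has_deriv)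
  ultimately show ?thesis
    unfolding circle_fun_def using DERIV_unique by blast
qed

text \<open>By duality \<open>\<psi>'\<close> is composed with \<open>F\<close>, and the chain rule
  makes this the derivative of \<open>\<psi> (F x)\<close> divided by \<open>F'\<close>. The factor
  \<open>1 / F'\<close> is then absorbed into \<open>f\<close>, and the product rule
  applies.\<close>

lemma transfer_op_weak_deriv:
  assumes wd: "has_weak_deriv f f'"
    and w: "\<And>x. ((\<lambda>x. 1 / F' x) has_real_derivative w' x) (at x)" "continuous_on UNIV w'"
  shows "has_weak_deriv (transfer_op F f) (transfer_op F (\<lambda>x. f' x * (1 / F' x) + f x * w' x))"
proof -
  have per: "circle_fun (\<lambda>x. 1 / F' x)"
    using circle_fun_F' by (simp add: circle_fun_def)
  have wd1: "has_weak_deriv (\<lambda>x. f x * (1 / F' x)) (\<lambda>x. f' x * (1 / F' x) + f x * w' x)"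
    using w per by (intro has_weak_deriv_mult[OF wd] circle_fun_derivative[OF per w(1)]) auto
  show ?thesis
  proof (rule has_weak_derivI_C1)
    fix \<psi> \<psi>' assume \<psi>: "circle_fun \<psi>" "\<And>x. (\<psi> has_real_derivative \<psi>' x) (at x)"
      "continuous_on UNIV \<psi>" "circle_fun \<psi>'" "continuous_on UNIV \<psi>'"
    have d: "((\<lambda>x. \<psi> (F x)) has_real_derivative \<psi>' (F x) * F' x) (at x)" for x
      by (rule DERIV_chain2[OF \<psi>(2) has_deriv])
    have "f x * \<psi>' (F x) = f x * (1 / F' x) * (\<psi>' (F x) * F' x)" for x
      using deriv_pos[of x] by simp
    then have "circle_int (\<lambda>x. transfer_op F f x * \<psi>' x) =
        circle_int (\<lambda>x. f x * (1 / F' x) * (\<psi>' (F x) * F' x))"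
      using transfer_op_dual[OF has_weak_deriv_L1(1)[OF wd] \<psi>(4,5)] by presburger
    also have "\<dots> = - circle_int (\<lambda>x. (f' x * (1 / F' x) + f x * w' x) * \<psi> (F x))"
      by (rule has_weak_deriv_C1[OF wd1 circle_fun_comp_F[OF \<psi>(1)] d
            continuous_on_mult[OF continuous_comp_F[OF \<psi>(5)] deriv_cont]])
    also have "circle_int (\<lambda>x. (f' x * (1 / F' x) + f x * w' x) * \<psi> (F x)) =
        circle_int (\<lambda>x. transfer_op F (\<lambda>x. f' x * (1 / F' x) + f x * w' x) x * \<psi> x)"
      by (rule transfer_op_dual[OF has_weak_deriv_L1(2)[OF wd1] \<psi>(1,3), symmetric])
    finally show "circle_int (\<lambda>x. transfer_op F f x * \<psi>' x) =
        - circle_int (\<lambda>x. transfer_op F (\<lambda>x. f' x * (1 / F' x) + f x * w' x) x * \<psi> x)" .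
  qed (use has_weak_deriv_L1[OF wd] has_weak_deriv_L1[OF wd1] transfer_op_L1 in auto)
qed

end

section \<open>Nearly linear expanding maps\<close>

text \<open>The weight \<open>w\<close> and its two derivatives are parameters with quantitative
  bounds, so that the estimates below do not return to derivatives of the lift. The size \<epsilon>
  measures the distance to a linear map, for which \<open>w'\<close> and \<open>w''\<close>
  vanish.\<close>

locale nearly_linear_cover = circle_cover +
  fixes w w' w'' :: "real \<Rightarrow> real" and \<epsilon> :: real
  assumes w_def: "w = (\<lambda>x. 1 / F' x)"
    and w_deriv: "(w has_real_derivative w' x) (at x)"
    and w'_deriv: "(w' has_real_derivative w'' x) (at x)"
    and w''_cont: "continuous_on UNIV w''"
    and \<epsilon>: "\<epsilon> \<le> 1 / 2"
    and w_le: "\<bar>w x\<bar> \<le> 2 / 3" and w'_le: "\<bar>w' x\<bar> \<le> \<epsilon>" and w''_le: "\<bar>w'' x\<bar> \<le> 2 * \<epsilon>"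
begin

lemma \<epsilon>_nonneg: "0 \<le> \<epsilon>"
  using w'_le[of 0] by linarith

lemma w_periodic: "circle_fun w" "circle_fun w'" "circle_fun w''"
proof -
  show "circle_fun w"
    using circle_fun_F' by (simp add: w_def circle_fun_def)
  then show "circle_fun w'"
    using w_deriv by (rule circle_fun_derivative)
  then show "circle_fun w''"
    using w'_deriv by (rule circle_fun_derivative)
qed

lemma w_continuous: "continuous_on UNIV w" "continuous_on UNIV w'"
  using w_deriv w'_deriv by (auto intro!: continuous_at_imp_continuous_on DERIV_isCont)

lemma weak_deriv_weighted:
  assumes "has_weak_deriv f f'"
  shows "has_weak_deriv (\<lambda>x. f x * w x) (\<lambda>x. f' x * w x + f x * w' x)"
    and "has_weak_deriv (\<lambda>x. f x * w' x) (\<lambda>x. f' x * w' x + f x * w'' x)"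
  using assms w_periodic w_continuous w''_cont w_deriv w'_deriv by (auto intro!: has_weak_deriv_mult)

lemma transfer_op_weak_deriv_w:
  assumes "has_weak_deriv f f'"
  shows "has_weak_deriv (transfer_op F f) (transfer_op F (\<lambda>x. f' x * w x + f x * w' x))"
  using transfer_op_weak_deriv[OF assms, of w'] w_deriv w_continuous by (simp add: w_def)

text \<open>The Lasota-Yorke inequality before transfer: the derivative is contracted by 2/3, and
  the function itself enters only with the small factor \<epsilon>.\<close>

lemma L1_norm_weighted_le:
  assumes "f' \<in> circle_L1" "f \<in> circle_L1"
  shows "L1_norm (\<lambda>x. f' x * w x + f x * w' x) \<le> 2 / 3 * L1_norm f' + \<epsilon> * L1_norm f"
  using L1_norm_add_le[OF circle_L1_mult[OF assms(1) w_periodic(1) w_continuous(1)]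
      circle_L1_mult[OF assms(2) w_periodic(2) w_continuous(2)]]
    L1_norm_mult_le[OF assms(1) w_periodic(1) w_continuous(1) w_le]
    L1_norm_mult_le[OF assms(2) w_periodic(2) w_continuous(2) w'_le]
  by linarith

text \<open>Invariance identifies \<open>h'\<close> and \<open>h''\<close>, up to null sets, with
  the once and twice differentiated transfer of the translate \<open>f\<close> of \<open>h\<close>.
  Translation preserves L1 norms, so the Lasota-Yorke bounds contain the same norms on both sides
  and the contracted terms can be absorbed on the left.\<close>

lemma fixed_density_bounds:
  assumes h: "prob_density h" and h': "has_weak_deriv h h'" and h'': "has_weak_deriv h' h''"
    and inv: "AE x in lebesgue. transfer_op F (\<lambda>x. h (x - c)) x = h x"
  shows "L1_norm h' \<le> 3 * \<epsilon>" "L1_norm h'' \<le> 10 * \<epsilon>"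
proof -
  have hL: "h \<in> circle_L1" using h by (simp add: prob_density_def)
  have "L1_norm h = circle_int h"
    using h hL by (intro circle_int_cong_AE circle_L1_abs) (auto simp: prob_density_def)
  then have h1: "L1_norm h = 1"
    using h by (simp add: prob_density_def)
  define f f' f'' where "f x = h (x + (- c))" and "f' x = h' (x + (- c))" and "f'' x = h'' (x + (- c))" for x
  have f: "has_weak_deriv f f'" and f': "has_weak_deriv f' f''"
    unfolding f_def f'_def f''_def by (intro has_weak_deriv_shift h' h'')+
  note L = has_weak_deriv_L1[OF f] has_weak_deriv_L1(2)[OF f']
  have n: "L1_norm f = 1" "L1_norm f' = L1_norm h'" "L1_norm f'' = L1_norm h''"
    unfolding f_def f'_def f''_def
    using h1 has_weak_deriv_L1[OF h'] has_weak_deriv_L1[OF h''] by (simp_all only: L1_norm_shift)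
  define g where "g x = f' x * w x + f x * w' x" for x
  define g' where "g' x = f'' x * w x + f' x * w' x + (f' x * w' x + f x * w'' x)" for x
  have g: "has_weak_deriv g g'"
    unfolding g_def[abs_def] g'_def[abs_def]
    by (intro has_weak_deriv_add weak_deriv_weighted f f')
  note gL = has_weak_deriv_L1[OF g]
  have Tf: "has_weak_deriv (transfer_op F f) (transfer_op F g)"
    using transfer_op_weak_deriv_w[OF f] by (simp add: g_def[abs_def])
  have "AE x in lebesgue. transfer_op F f x = h x"
    using inv by (simp add: f_def[abs_def])
  then have hg: "has_weak_deriv h (transfer_op F g)"
    by (rule has_weak_deriv_cong[OF Tf hL L1_norm_diff_eq_0[OF has_weak_deriv_L1(1)[OF Tf] hL]])
  \<comment> \<open>Both \<open>h'\<close> and \<open>transfer_op F g\<close> are weak derivatives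
    of \<open>h\<close>, so their difference is one of the zero function and has norm zero. This
    lets \<open>h''\<close> serve as weak derivative of \<open>transfer_op F g\<close>.\<close>
  have 0: "has_weak_deriv (\<lambda>x. 0) (\<lambda>x. h' x - transfer_op F g x)"
    using has_weak_deriv_diff[OF h' hg] by simp
  have "has_weak_deriv (\<lambda>x. 0) (\<lambda>x. 0)"
    using has_weak_deriv_cmult[OF h', of 0] by simp
  from L1_norm_weak_deriv_unique[OF 0 this]
  have "L1_norm (\<lambda>x. h' x - transfer_op F g x) = 0"
    by (simp add: circle_int_eq)
  then have "has_weak_deriv (transfer_op F g) h''"
    by (rule has_weak_deriv_cong[OF h'' transfer_op_L1[OF gL(1)]])
  then have "L1_norm h'' = L1_norm (transfer_op F (\<lambda>x. g' x * w x + g x * w' x))"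
    using transfer_op_weak_deriv_w[OF g] L1_norm_weak_deriv_unique by blast
  also have "\<dots> \<le> L1_norm (\<lambda>x. g' x * w x + g x * w' x)"
    using has_weak_deriv_L1 w_periodic w_continuous gL
    by (intro L1_norm_transfer_op_le circle_L1_add circle_L1_mult)
  also have "\<dots> \<le> 2 / 3 * L1_norm g' + \<epsilon> * L1_norm g"
    using gL by (intro L1_norm_weighted_le)
  finally have z: "L1_norm h'' \<le> 2 / 3 * L1_norm g' + \<epsilon> * L1_norm g" .
  have gn: "L1_norm g \<le> 2 / 3 * L1_norm h' + \<epsilon>"
    using L1_norm_weighted_le[OF L(2,1)] n by (simp add: g_def)
  have "L1_norm h' = L1_norm (transfer_op F g)"
    using hg h' L1_norm_weak_deriv_unique by blast
  also have "\<dots> \<le> L1_norm g"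
    using gL by (intro L1_norm_transfer_op_le)
  finally have "L1_norm h' \<le> L1_norm g" .
  with gn show y: "L1_norm h' \<le> 3 * \<epsilon>" by linarith
  have "L1_norm g' \<le> L1_norm (\<lambda>x. f'' x * w x + f' x * w' x) + L1_norm (\<lambda>x. f' x * w' x + f x * w'' x)"
    unfolding g'_def
    using has_weak_deriv_L1(2)[OF weak_deriv_weighted(1)[OF f']]
      has_weak_deriv_L1(2)[OF weak_deriv_weighted(2)[OF f]] by (rule L1_norm_add_le)
  moreover have "L1_norm (\<lambda>x. f'' x * w x + f' x * w' x) \<le> 2 / 3 * L1_norm h'' + \<epsilon> * L1_norm h'"
    using L1_norm_weighted_le[OF L(3,2)] n by simp
  moreover have "L1_norm (\<lambda>x. f' x * w' x + f x * w'' x) \<le> \<epsilon> * L1_norm h' + 2 * \<epsilon>"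
    using L1_norm_add_le[OF circle_L1_mult[OF L(2) w_periodic(2) w_continuous(2)]
        circle_L1_mult[OF L(1) w_periodic(3) w''_cont]]
      L1_norm_mult_le[OF L(2) w_periodic(2) w_continuous(2) w'_le]
      L1_norm_mult_le[OF L(1) w_periodic(3) w''_cont w''_le] n
    by simp
  ultimately have g'n: "L1_norm g' \<le> 2 / 3 * L1_norm h'' + 2 * (\<epsilon> * L1_norm h') + 2 * \<epsilon>"
    by linarith
  \<comment> \<open>The quadratic terms are made linear in \<epsilon> by \<epsilon> \<le>
    1/2.\<close>
  have "\<epsilon> * L1_norm h' \<le> 1 / 2 * (3 * \<epsilon>)"
    using y \<epsilon> \<epsilon>_nonneg by (intro mult_mono L1_norm_nonneg) auto
  moreover have "\<epsilon> * L1_norm g \<le> 1 / 2 * (3 * \<epsilon>)"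
    using gn y \<epsilon> \<epsilon>_nonneg by (intro mult_mono L1_norm_nonneg) auto
  \<comment> \<open>Altogether the norm of \<open>h''\<close> is at most 4/9 of itself plus 29/6
    times \<epsilon>, hence at most 8.7 times \<epsilon>.\<close>
  ultimately show "L1_norm h'' \<le> 10 * \<epsilon>"
    using z g'n \<epsilon>_nonneg by linarith
qed

text \<open>
  With \<open>c\<close> and \<open>c'\<close> the translations associated with \<open>h\<close> and \<open>\<eta>\<close>, the difference of the images is
  the transfer of \<open>(h (\<cdot> - c) - h (\<cdot> - c')) + (h - \<eta>) (\<cdot> - c')\<close>. The second term contracts, and the first
  one costs \<open>\<bar>c - c'\<bar>\<close> times the norm of \<open>h''\<close>, which is \<open>O(\<epsilon>)\<close> because \<open>h\<close> is nearly constant.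
\<close>

lemma self_consistent_op_contracts:
  assumes h: "prob_density h" "has_weak_deriv h h'" "has_weak_deriv h' h''"
    and inv: "AE x in lebesgue. self_consistent_op F H \<delta> h x = h x"
    and H: "circle_fun H" "continuous_on UNIV H" "\<And>x. \<bar>H x\<bar> \<le> A" and \<delta>: "\<delta> \<ge> 0"
    and \<eta>: "\<eta> \<in> circle_L1" "circle_int \<eta> = 1" "has_weak_deriv (\<lambda>x. h x - \<eta> x) D"
  obtains D' where "has_weak_deriv (\<lambda>x. h x - self_consistent_op F H \<delta> \<eta> x) D'"
    "L1_norm D' \<le> (2 / 3 + 2 * \<epsilon> + 20 * \<delta> * A * \<epsilon>) * L1_norm D"
    "self_consistent_op F H \<delta> \<eta> \<in> circle_L1" "circle_int (self_consistent_op F H \<delta> \<eta>) = 1"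
proof -
  define c where "c = \<delta> * circle_int (\<lambda>y. H y * h y)"
  define c' where "c' = \<delta> * circle_int (\<lambda>y. H y * \<eta> y)"
  define X where "X = L1_norm D"
  have X: "X \<ge> 0" by (simp add: X_def L1_norm_nonneg)
  have A: "A \<ge> 0" using H(3)[of 0] by linarith
  have hL: "h \<in> circle_L1" "circle_int h = 1" using h by (simp_all add: prob_density_def)
  have Lh: "self_consistent_op F H \<delta> h = transfer_op F (\<lambda>x. h (x + (- c)))"
    by (simp add: self_consistent_op_def mean_field_op_def[abs_def] c_def)
  have L\<eta>: "self_consistent_op F H \<delta> \<eta> = transfer_op F (\<lambda>x. \<eta> (x + (- c')))"
    by (simp add: self_consistent_op_def mean_field_op_def[abs_def] c'_def)
  have Th: "AE x in lebesgue. transfer_op F (\<lambda>x. h (x - c)) x = h x"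
    using inv by (simp add: Lh)
  note bounds = fixed_density_bounds[OF h Th]
  note dL = has_weak_deriv_L1[OF \<eta>(3)]
  \<comment> \<open>Equal masses make the Poincare inequality available, so the single quantity
    \<open>X\<close> controls the difference as well as its derivative.\<close>
  have "circle_int (\<lambda>x. h x - \<eta> x) = 0"
    using circle_int_diff[OF hL(1) \<eta>(1)] hL(2) \<eta>(2) by simp
  then have diff: "L1_norm (\<lambda>x. h x - \<eta> x) \<le> 2 * X"
    unfolding X_def by (rule poincare[OF \<eta>(3)])
  \<comment> \<open>The translations see the densities only through their pairings with
    \<open>H\<close>; the factor 2 comes from the Poincare inequality.\<close>
  have cc: "\<bar>c - c'\<bar> \<le> 2 * (\<delta> * A * X)"
  proof -
    have "c - c' = \<delta> * circle_int (\<lambda>y. (h y - \<eta> y) * H y)"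
      using circle_int_diff[OF circle_L1_mult[OF hL(1) H(1,2)] circle_L1_mult[OF \<eta>(1) H(1,2)]]
      by (simp add: c_def c'_def left_diff_distrib right_diff_distrib mult.commute)
    moreover have "\<bar>circle_int (\<lambda>y. (h y - \<eta> y) * H y)\<bar> \<le> A * (2 * X)"
      using abs_circle_int_mult_le[OF dL(1) H] mult_left_mono[OF diff A] by linarith
    ultimately show ?thesis
      using mult_left_mono[OF _ \<delta>] by (fastforce simp: abs_mult \<delta>)
  qed
  define q where "q x = (h (x + (- c)) - h (x + (- c'))) + (h (x + (- c')) - \<eta> (x + (- c')))" for x
  define q' where "q' x = (h' (x + (- c)) - h' (x + (- c'))) + D (x + (- c'))" for x
  have q: "has_weak_deriv q q'"
    unfolding q_def[abs_def] q'_def[abs_def]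
    by (intro has_weak_deriv_add has_weak_deriv_diff has_weak_deriv_shift h has_weak_deriv_shift[OF \<eta>(3)])
  note qL = has_weak_deriv_L1[OF q]
  have sh: "(\<lambda>x. u (x + a)) \<in> circle_L1" if "u \<in> circle_L1" for u a
    using that by (rule circle_shift(1))
  have "L1_norm q \<le> L1_norm (\<lambda>x. h (x + (- c)) - h (x + (- c'))) +
      L1_norm (\<lambda>x. h (x + (- c')) - \<eta> (x + (- c')))"
    unfolding q_def
    by (rule L1_norm_add_le[OF circle_L1_diff[OF sh[OF hL(1)] sh[OF hL(1)]]
          circle_L1_diff[OF sh[OF hL(1)] sh[OF \<eta>(1)]]])
  moreover have "L1_norm (\<lambda>x. h (x + (- c)) - h (x + (- c'))) \<le> \<bar>c - c'\<bar> * (3 * \<epsilon>)"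
    using L1_norm_shift_diff_le[OF h(2), of "- c" "- c'"] mult_left_mono[OF bounds(1), of "\<bar>c - c'\<bar>"]
    by (simp add: abs_minus_commute)
  moreover have "L1_norm (\<lambda>x. h (x + (- c')) - \<eta> (x + (- c'))) \<le> 2 * X"
    using L1_norm_shift[OF dL(1), of "- c'"] diff by simp
  ultimately have nq: "L1_norm q \<le> \<bar>c - c'\<bar> * (3 * \<epsilon>) + 2 * X"
    by linarith
  have "L1_norm q' \<le> L1_norm (\<lambda>x. h' (x + (- c)) - h' (x + (- c'))) + L1_norm (\<lambda>x. D (x + (- c')))"
    unfolding q'_def
    by (rule L1_norm_add_le[OF circle_L1_diff[OF sh sh] sh])
      (use has_weak_deriv_L1[OF h(2)] dL in auto)
  moreover have "L1_norm (\<lambda>x. h' (x + (- c)) - h' (x + (- c'))) \<le> \<bar>c - c'\<bar> * (10 * \<epsilon>)"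
    using L1_norm_shift_diff_le[OF h(3), of "- c" "- c'"] mult_left_mono[OF bounds(2), of "\<bar>c - c'\<bar>"]
    by (simp add: abs_minus_commute)
  moreover have "L1_norm (\<lambda>x. D (x + (- c'))) = X"
    using L1_norm_shift[OF dL(2), of "- c'"] by (simp add: X_def)
  ultimately have nq': "L1_norm q' \<le> \<bar>c - c'\<bar> * (10 * \<epsilon>) + X"
    by linarith
  define D' where "D' = transfer_op F (\<lambda>x. q' x * w x + q x * w' x)"
  have Tq: "has_weak_deriv (transfer_op F q) D'"
    unfolding D'_def by (rule transfer_op_weak_deriv_w[OF q])
  have \<eta>sL: "(\<lambda>x. \<eta> (x + (- c'))) \<in> circle_L1"
    using \<eta>(1) by (rule sh)
  then have L\<eta>L: "self_consistent_op F H \<delta> \<eta> \<in> circle_L1"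
    unfolding L\<eta> by (rule transfer_op_L1)
  have Tq_eq: "transfer_op F q x = self_consistent_op F H \<delta> h x - self_consistent_op F H \<delta> \<eta> x" for x
    using transfer_op_diff[of "\<lambda>x. h (x + (- c))" "\<lambda>x. \<eta> (x + (- c'))" x]
    by (simp add: Lh L\<eta> q_def[abs_def])
  have "has_weak_deriv (\<lambda>x. h x - self_consistent_op F H \<delta> \<eta> x) D'"
  proof (rule has_weak_deriv_cong[OF Tq])
    show L: "(\<lambda>x. h x - self_consistent_op F H \<delta> \<eta> x) \<in> circle_L1"
      by (rule circle_L1_diff[OF hL(1) L\<eta>L])
    have "AE x in lebesgue. transfer_op F q x = h x - self_consistent_op F H \<delta> \<eta> x"
      using inv by eventually_elim (simp add: Tq_eq)
    then show "L1_norm (\<lambda>x. transfer_op F q x - (h x - self_consistent_op F H \<delta> \<eta> x)) = 0"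
      by (rule L1_norm_diff_eq_0[OF has_weak_deriv_L1(1)[OF Tq] L])
  qed
  moreover have "L1_norm D' \<le> (2 / 3 + 2 * \<epsilon> + 20 * \<delta> * A * \<epsilon>) * L1_norm D"
  proof -
    have "L1_norm D' \<le> L1_norm (\<lambda>x. q' x * w x + q x * w' x)"
      unfolding D'_def using w_periodic w_continuous qL
      by (intro L1_norm_transfer_op_le circle_L1_add circle_L1_mult)
    also have "\<dots> \<le> 2 / 3 * L1_norm q' + \<epsilon> * L1_norm q"
      by (rule L1_norm_weighted_le[OF qL(2,1)])
    also have "\<dots> \<le> 2 / 3 * (\<bar>c - c'\<bar> * (10 * \<epsilon>) + X) + \<epsilon> * (\<bar>c - c'\<bar> * (3 * \<epsilon>) + 2 * X)"
      using nq nq' \<epsilon>_nonneg by (intro add_mono mult_left_mono) auto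
    also have "\<dots> = (\<bar>c - c'\<bar> * \<epsilon>) * (20 / 3 + 3 * \<epsilon>) + (2 / 3 + 2 * \<epsilon>) * X"
      by (simp add: algebra_simps)
    \<comment> \<open>Here \<epsilon> \<le> 1/2 gives
      \<open>20 / 3 + 3 * \<epsilon> \<le> 10\<close>.\<close>
    also have "\<dots> \<le> (2 * (\<delta> * A * X) * \<epsilon>) * 10 + (2 / 3 + 2 * \<epsilon>) * X"
      using cc \<epsilon> \<epsilon>_nonneg \<delta> A X by (intro add_mono mult_mono) auto
    also have "\<dots> = (2 / 3 + 2 * \<epsilon> + 20 * \<delta> * A * \<epsilon>) * L1_norm D"
      by (simp add: X_def algebra_simps)
    finally show ?thesis .
  qed
  moreover have "circle_int (self_consistent_op F H \<delta> \<eta>) = 1"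
    unfolding L\<eta> using circle_int_transfer_op[OF \<eta>sL] circle_shift(2)[OF \<eta>(1), of "- c'"] \<eta>(2) by simp
  ultimately show ?thesis using that L\<eta>L by blast
qed

end

section \<open>Contraction towards the fixed density\<close>

lemma C_diff_linear: "C_diff n (\<lambda>x. a * x)"
proof (cases n)
  case (Suc m)
  show ?thesis
    unfolding Suc by (rule C_diff_SucI[OF _ C_diff_const]) (auto intro!: derivative_eq_intros)
qed (auto simp: C_diff_def intro!: continuous_intros)

lemma deriv_linear: "deriv (\<lambda>x::real. a * x) = (\<lambda>x. a)"
  by (intro ext DERIV_imp_deriv) (auto intro!: derivative_eq_intros)

lemma deriv_linear_iter: "(deriv ^^ Suc (Suc i)) (\<lambda>x::real. a * x) = (\<lambda>x. 0)"
  by (induction i) (simp_all add: deriv_linear)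

text \<open>Subtracting the linear function of slope \<open>d\<close> turns a lift into a periodic
  function and changes the derivative by a constant only.\<close>

lemma circle_lift_deriv:
  assumes "circle_lift F" "\<And>x. (F has_real_derivative F' x) (at x)"
  shows "circle_fun F'"
proof -
  obtain d where d: "\<And>x. F (x + 1) = F x + of_int d"
    using assms(1) by (auto simp: circle_lift_def)
  have "circle_fun (\<lambda>x. F x - of_int d * x)"
    by (simp add: circle_fun_def d distrib_left)
  moreover have "((\<lambda>x. F x - of_int d * x) has_real_derivative F' x - of_int d) (at x)" for x
    by (auto intro!: derivative_eq_intros assms(2))
  ultimately have "circle_fun (\<lambda>x. F' x - of_int d)"
    by (rule circle_fun_derivative)
  then show ?thesis by (simp add: circle_fun_def)
qed

text \<open>Order zero is excluded because a lift itself is periodic only up to an integer; from the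
  first derivative on, periodicity is inherited.\<close>

lemma circle_lift_deriv_iter:
  assumes "circle_lift F" "C_diff n F" "0 < i" "i \<le> n"
  shows "circle_fun ((deriv ^^ i) F) \<and> C_diff (n - i) ((deriv ^^ i) F)"
  using assms(3,4)
proof (induction i)
  case (Suc i)
  have eq: "n - i = Suc (n - Suc i)" using Suc.prems by simp
  have C: "C_diff (Suc (n - Suc i)) ((deriv ^^ i) F)"
    using Suc assms(2) by (cases "i = 0") (simp_all add: eq)
  note d = C_diff_has_derivative[OF C]
  have "circle_fun (deriv ((deriv ^^ i) F))"
  proof (cases "i = 0")
    case True
    then show ?thesis using circle_lift_deriv[OF assms(1)] d by simp
  next
    case False
    then have "circle_fun ((deriv ^^ i) F)" using Suc by simp
    then show ?thesis using d by (rule circle_fun_derivative)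
  qed
  then show ?case
    using C by (simp add: C_diff_Suc)
qed simp

text \<open>A real supremum bounds its terms only when the range is bounded above; periodicity and
  continuity of the derivatives provide this. For order zero \<open>C_dist\<close> compares values
  modulo 1, so only positive orders are treated.\<close>

lemma C_dist_deriv_le:
  assumes F: "circle_lift F" "C_diff n F" and G: "circle_lift G" "C_diff n G" and i: "0 < i" "i \<le> n"
  shows "\<bar>(deriv ^^ i) F x - (deriv ^^ i) G x\<bar> \<le> C_dist n F G"
proof -
  let ?f = "\<lambda>i x. if i = 0 then infdist (F x - G x) \<int> else \<bar>(deriv ^^ i) F x - (deriv ^^ i) G x\<bar>"
  have 1: "circle_fun (\<lambda>x. (deriv ^^ i) F x - (deriv ^^ i) G x)"
    "continuous_on UNIV (\<lambda>x. (deriv ^^ i) F x - (deriv ^^ i) G x)"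
    using circle_lift_deriv_iter[OF F i] circle_lift_deriv_iter[OF G i]
    by (blast intro: circle_fun_diff continuous_on_diff C_diff_imp_continuous)+
  obtain K where "\<And>x. \<bar>(deriv ^^ i) F x - (deriv ^^ i) G x\<bar> \<le> K"
    using circle_fun_bounded[OF 1] by blast
  then have "bdd_above (range (?f i))"
    using i by (auto intro!: bdd_aboveI[of _ K])
  then have "?f i x \<le> (SUP x. ?f i x)"
    by (rule cSUP_upper[OF UNIV_I])
  moreover have "(SUP x. ?f i x) \<in> (\<lambda>i. SUP x. ?f i x) ` {..n}"
    using i by (intro imageI) simp
  then have "(SUP x. ?f i x) \<le> C_dist n F G"
    unfolding C_dist_def by (intro Max_ge finite_imageI finite_atMost)
  ultimately show ?thesis using i by simp
qed

text \<open>Since \<open>k\<close> is at least 2 and \<epsilon> at most 1/2, the derivative of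
  \<open>F\<close> is at least 3/2, whence the bound 2/3 on \<open>w\<close>. The other bounds
  follow from the explicit formulas for \<open>w'\<close> and \<open>w''\<close>.\<close>

lemma nearly_linear_coverI:
  assumes F: "circle_lift F" "C_diff 3 F" and \<epsilon>: "0 \<le> \<epsilon>" "\<epsilon> \<le> 1 / 2" and k: "2 \<le> k"
    and d1: "\<And>x. \<bar>k - deriv F x\<bar> \<le> \<epsilon>" and d2: "\<And>x. \<bar>(deriv ^^ 2) F x\<bar> \<le> \<epsilon>"
    and d3: "\<And>x. \<bar>(deriv ^^ 3) F x\<bar> \<le> \<epsilon>"
  obtains d w w' w'' where "nearly_linear_cover F (deriv F) d w w' w'' \<epsilon>"
proof -
  define F1 F2 F3 where "F1 = deriv F" and "F2 = deriv F1" and "F3 = deriv F2"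
  have C: "C_diff (Suc (Suc (Suc 0))) F" "C_diff (Suc (Suc 0)) F1" "C_diff (Suc 0) F2" "C_diff 0 F3"
    using F(2) by (simp_all add: F1_def F2_def F3_def C_diff_Suc numeral_3_eq_3)
  have D: "(F has_real_derivative F1 x) (at x)" "(F1 has_real_derivative F2 x) (at x)"
    "(F2 has_real_derivative F3 x) (at x)" for x
    using C(1-3)[THEN C_diff_has_derivative] by (simp_all add: F1_def F2_def F3_def)
  have cont: "continuous_on UNIV F1" "continuous_on UNIV F2" "continuous_on UNIV F3"
    using C C_diff_imp_continuous by blast+
  have F1: "3 / 2 \<le> F1 x" and F2: "\<bar>F2 x\<bar> \<le> \<epsilon>" and F3: "\<bar>F3 x\<bar> \<le> \<epsilon>" for x
    using d1[of x] d2[of x] d3[of x] \<epsilon> k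
    by (auto simp: F1_def F2_def F3_def eval_nat_numeral)
  obtain d :: int where d: "\<And>x. F (x + 1) = F x + of_int d"
    using F(1) by (auto simp: circle_lift_def)
  have pos: "F1 x > 0" for x using F1[of x] by linarith
  have "F 0 < F 1"
    by (meson DERIV_pos_imp_increasing D(1) pos zero_less_one)
  then have dpos: "d > 0" using d[of 0] by simp
  define w where "w x = 1 / F1 x" for x
  define w' where "w' x = - (F2 x * (w x)\<^sup>2)" for x
  define w'' where "w'' x = - (F3 x * (w x)\<^sup>2) + 2 * ((F2 x)\<^sup>2 * (w x) ^ 3)" for x
  have ne: "F1 x \<noteq> 0" for x using pos[of x] by simp
  have w: "0 \<le> w x" "w x \<le> 2 / 3" for x
    using F1[of x] by (auto simp: w_def field_simps)
  have dw: "(w has_real_derivative w' x) (at x)" for x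
    unfolding w_def[abs_def] w'_def
    using ne by (auto intro!: derivative_eq_intros D simp: power2_eq_square)
  have dw': "(w' has_real_derivative w'' x) (at x)" for x
    unfolding w'_def[abs_def] w''_def
    by (auto intro!: derivative_eq_intros D dw simp: w'_def power2_eq_square power3_eq_cube)
  have w_cont: "continuous_on UNIV w"
    using dw by (auto intro!: continuous_at_imp_continuous_on DERIV_isCont)
  have "nearly_linear_cover F (deriv F) (nat d) w w' w'' \<epsilon>"
    unfolding F1_def[symmetric]
  proof
    fix x
    have sq: "(w x)\<^sup>2 \<le> 1" "(w x) ^ 3 \<le> 1"
      using w[of x] by (auto intro!: power_le_one)
    show "F (x + 1) = F x + real (nat d)" using d dpos by simp
    show "continuous_on UNIV F1" by (rule cont)
    show "continuous_on UNIV w''"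
      unfolding w''_def[abs_def] by (intro continuous_intros cont w_cont)
    show "\<bar>w x\<bar> \<le> 2 / 3" using w[of x] by simp
    have "\<bar>F2 x * (w x)\<^sup>2\<bar> \<le> \<epsilon> * 1"
      unfolding abs_mult using F2[of x] sq \<epsilon> by (intro mult_mono) auto
    then show "\<bar>w' x\<bar> \<le> \<epsilon>" by (simp add: w'_def)
    have "\<bar>F3 x * (w x)\<^sup>2\<bar> \<le> \<epsilon> * 1"
      unfolding abs_mult using F3[of x] sq \<epsilon> by (intro mult_mono) auto
    \<comment> \<open>One factor is bounded by \<epsilon> and the other by 1/2, so the doubled
      quadratic term of \<open>w''\<close> costs at most one further \<epsilon>.\<close>
    moreover have "(F2 x)\<^sup>2 \<le> \<epsilon> * (1 / 2)"
      using mult_mono[of "\<bar>F2 x\<bar>" \<epsilon> "\<bar>F2 x\<bar>" "1 / 2"] F2[of x] \<epsilon> by (simp add: power2_eq_square)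
    then have "(F2 x)\<^sup>2 * (w x) ^ 3 \<le> (\<epsilon> * (1 / 2)) * 1"
      using sq w[of x] \<epsilon> by (intro mult_mono) auto
    moreover have "0 \<le> (F2 x)\<^sup>2 * (w x) ^ 3"
      using w[of x] by simp
    ultimately show "\<bar>w'' x\<bar> \<le> 2 * \<epsilon>"
      unfolding w''_def by linarith
  qed (use D pos dw dw' \<epsilon> in \<open>auto simp: w_def\<close>)
  then show ?thesis by (rule that)
qed

theorem proposition12:
  fixes k :: int
    and H :: "real \<Rightarrow> real"
    and T :: "real \<Rightarrow> real \<Rightarrow> real"
    and \<epsilon>' :: real
  assumes "k > 1"
    and "circle_fun H" and "C_diff 4 H"
    and "\<epsilon>' > 0"
    and "T 0 = (\<lambda>x. of_int k * x)"
    and "\<And>\<epsilon>. \<epsilon> \<in> {0<..<\<epsilon>'} \<Longrightarrow> circle_lift (T \<epsilon>) \<and> C_diff 4 (T \<epsilon>)"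
    and "\<And>\<epsilon>. \<epsilon> \<in> {0<..<\<epsilon>'} \<Longrightarrow> C_dist 4 (T 0) (T \<epsilon>) \<le> \<epsilon>"
    and "\<exists>\<sigma>>1. \<forall>\<epsilon>\<in>{0<..<\<epsilon>'}. \<forall>x. deriv (T \<epsilon>) x \<ge> \<sigma>"
  shows "\<forall>\<delta>>0. \<exists>\<epsilon>\<^sub>0\<in>{0<..<\<epsilon>'}. \<forall>h :: real \<Rightarrow> real \<Rightarrow> real.
           (\<forall>\<epsilon>\<in>{0..\<epsilon>\<^sub>0}. prob_density (h \<epsilon>) \<and> h \<epsilon> \<in> W1 3 \<and>
              (AE x in lebesgue. self_consistent_op (T \<epsilon>) H \<delta> (h \<epsilon>) x = h \<epsilon> x)) \<longrightarrow>
           (\<exists>C>0. \<exists>\<rho>>0. \<exists>lam>0. \<forall>\<epsilon>\<in>{0..\<epsilon>\<^sub>0}. \<forall>\<eta>.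
              prob_density \<eta> \<and> \<eta> \<in> W1 1 \<and> W1_norm 1 (\<lambda>x. h \<epsilon> x - \<eta> x) \<le> ennreal \<rho> \<longrightarrow>
              (\<forall>n::nat. W1_norm 1 (\<lambda>x. h \<epsilon> x - (self_consistent_op (T \<epsilon>) H \<delta> ^^ n) \<eta> x)
                          \<le> ennreal (C * exp (- lam * real n))))"
proof (intro allI impI)
  fix \<delta> :: real assume \<delta>: "\<delta> > 0"
  have H: "circle_fun H" "continuous_on UNIV H"
    using assms(2,3) C_diff_imp_continuous by auto
  obtain A where A: "\<And>x. \<bar>H x\<bar> \<le> A"
    using circle_fun_bounded[OF H] by blast
  have A0: "A \<ge> 0" using A[of 0] by linarith
  \<comment> \<open>The first bound keeps the parameter in the given range, the second is the one
    required of a nearly linear cover, and the third makes the nonlinear loss at most 1/6, so that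
    the contraction rate is at most 2/3 + 1/6 = 5/6.\<close>
  define \<epsilon>\<^sub>0 where "\<epsilon>\<^sub>0 = min (\<epsilon>' / 2) (min (1 / 2) (1 / (6 * (2 + 20 * \<delta> * A))))"
  have pos: "2 + 20 * \<delta> * A > 0" using \<delta> A0 by (intro add_pos_nonneg) auto
  then have \<epsilon>\<^sub>0: "\<epsilon>\<^sub>0 \<in> {0<..<\<epsilon>'}" using assms(4) by (auto simp: \<epsilon>\<^sub>0_def min_less_iff_disj)
  have cover: "\<exists>F' d w w' w''. nearly_linear_cover (T \<epsilon>) F' d w w' w'' \<epsilon>" if "\<epsilon> \<in> {0..\<epsilon>\<^sub>0}" for \<epsilon>
  proof -
    have lift0: "circle_lift (T 0)"
      by (auto simp: assms(5) circle_lift_def distrib_left)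
    have \<epsilon>: "0 \<le> \<epsilon>" "\<epsilon> \<le> 1 / 2" "\<epsilon> < \<epsilon>'"
      using that \<epsilon>\<^sub>0 by (auto simp: \<epsilon>\<^sub>0_def)
    have k: "2 \<le> real_of_int k" using assms(1) by linarith
    have C0: "C_diff n (T 0)" for n
      unfolding assms(5) by (rule C_diff_linear)
    have T: "circle_lift (T \<epsilon>)" "C_diff 4 (T \<epsilon>)"
      using assms(6)[of \<epsilon>] \<epsilon> lift0 C0 by (cases "\<epsilon> = 0"; simp)+
    \<comment> \<open>The distance hypothesis covers positive parameters only; at parameter 0 the
      difference vanishes.\<close>
    have "\<bar>(deriv ^^ i) (T 0) x - (deriv ^^ i) (T \<epsilon>) x\<bar> \<le> \<epsilon>" if "0 < i" "i \<le> 4" for i x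
    proof (cases "\<epsilon> = 0")
      case False
      then have "C_dist 4 (T 0) (T \<epsilon>) \<le> \<epsilon>" using assms(7) \<epsilon> by simp
      then show ?thesis
        using C_dist_deriv_le[OF lift0 C0 T that, of x] by linarith
    qed simp
    from this[of 1] this[of 2] this[of 3] show ?thesis
      using nearly_linear_coverI[OF T(1) _ \<epsilon>(1,2) k] T(2) C_diff_Suc_imp[of 3 "T \<epsilon>"]
        deriv_linear_iter[of 0 "real_of_int k"] deriv_linear_iter[of 1 "real_of_int k"]
      by (simp add: assms(5) deriv_linear eval_nat_numeral) metis
  qed
  have rate: "2 / 3 + 2 * \<epsilon> + 20 * \<delta> * A * \<epsilon> \<le> 5 / 6" if "\<epsilon> \<in> {0..\<epsilon>\<^sub>0}" for \<epsilon>
  proof -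
    have "\<epsilon> \<le> 1 / (6 * (2 + 20 * \<delta> * A))" using that by (auto simp: \<epsilon>\<^sub>0_def)
    then have "\<epsilon> * (2 + 20 * \<delta> * A) \<le> 1 / 6" using pos by (simp add: field_simps)
    then show ?thesis by (simp add: algebra_simps)
  qed
  show "\<exists>\<epsilon>\<^sub>0\<in>{0<..<\<epsilon>'}. \<forall>h :: real \<Rightarrow> real \<Rightarrow> real.
           (\<forall>\<epsilon>\<in>{0..\<epsilon>\<^sub>0}. prob_density (h \<epsilon>) \<and> h \<epsilon> \<in> W1 3 \<and>
              (AE x in lebesgue. self_consistent_op (T \<epsilon>) H \<delta> (h \<epsilon>) x = h \<epsilon> x)) \<longrightarrow>
           (\<exists>C>0. \<exists>\<rho>>0. \<exists>lam>0. \<forall>\<epsilon>\<in>{0..\<epsilon>\<^sub>0}. \<forall>\<eta>.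
              prob_density \<eta> \<and> \<eta> \<in> W1 1 \<and> W1_norm 1 (\<lambda>x. h \<epsilon> x - \<eta> x) \<le> ennreal \<rho> \<longrightarrow>
              (\<forall>n::nat. W1_norm 1 (\<lambda>x. h \<epsilon> x - (self_consistent_op (T \<epsilon>) H \<delta> ^^ n) \<eta> x)
                          \<le> ennreal (C * exp (- lam * real n))))"
  proof (rule bexI[OF _ \<epsilon>\<^sub>0], intro allI impI)
    fix h :: "real \<Rightarrow> real \<Rightarrow> real"
    assume h: "\<forall>\<epsilon>\<in>{0..\<epsilon>\<^sub>0}. prob_density (h \<epsilon>) \<and> h \<epsilon> \<in> W1 3 \<and>
              (AE x in lebesgue. self_consistent_op (T \<epsilon>) H \<delta> (h \<epsilon>) x = h \<epsilon> x)"
    \<comment> \<open>The witnesses do not depend on \<open>h\<close>: radius 1, rate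
      \<open>ln (6 / 5)\<close> from the factor 5/6, and constant 3, of which 2 comes from the
      Poincare inequality and 1 from the derivative.\<close>
    have main: "W1_norm 1 (\<lambda>x. h \<epsilon> x - (self_consistent_op (T \<epsilon>) H \<delta> ^^ n) \<eta> x)
        \<le> ennreal (3 * exp (- ln (6 / 5) * real n))"
      if rng: "\<epsilon> \<in> {0..\<epsilon>\<^sub>0}" and \<eta>: "prob_density \<eta>" "W1_norm 1 (\<lambda>x. h \<epsilon> x - \<eta> x) \<le> ennreal 1"
      for \<epsilon> \<eta> n
    proof -
      obtain F' d w w' w'' where "nearly_linear_cover (T \<epsilon>) F' d w w' w'' \<epsilon>"
        using cover[OF rng] by blast
      then interpret nearly_linear_cover "T \<epsilon>" F' d w w' w'' \<epsilon> .
      let ?L = "self_consistent_op (T \<epsilon>) H \<delta>"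
      have dens: "prob_density (h \<epsilon>)"
        and inv: "AE x in lebesgue. ?L (h \<epsilon>) x = h \<epsilon> x" and "h \<epsilon> \<in> W1 3"
        using h rng by auto
      from \<open>h \<epsilon> \<in> W1 3\<close> obtain h' h'' where h': "has_weak_deriv (h \<epsilon>) h'" "has_weak_deriv h' h''"
        by (auto simp: numeral_3_eq_3)
      \<comment> \<open>The norm is infinite outside the space, so the finite bound yields
        membership.\<close>
      have "(\<lambda>x. h \<epsilon> x - \<eta> x) \<in> W1 1"
        using \<eta>(2) by (rule contrapos_pp) (simp add: W1_norm_def top_unique)
      then obtain D where D: "has_weak_deriv (\<lambda>x. h \<epsilon> x - \<eta> x) D"
        by auto
      have D1: "L1_norm D \<le> 1"
        using \<eta>(2) L1_norm_nonneg[of "\<lambda>x. h \<epsilon> x - \<eta> x"]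
        unfolding W1_norm_1_eq[OF D] by (subst (asm) ennreal_le_iff) auto
      \<comment> \<open>Integrability and unit mass of the iterates are carried along, because the
        one-step contraction needs them for its Poincare inequality.\<close>
      have "\<exists>D. has_weak_deriv (\<lambda>x. h \<epsilon> x - (?L ^^ n) \<eta> x) D \<and> L1_norm D \<le> (5 / 6) ^ n \<and>
          (?L ^^ n) \<eta> \<in> circle_L1 \<and> circle_int ((?L ^^ n) \<eta>) = 1"
      proof (induction n)
        case 0
        show ?case using D D1 \<eta>(1) by (auto simp: prob_density_def)
      next
        case (Suc n)
        then obtain D where D: "has_weak_deriv (\<lambda>x. h \<epsilon> x - (?L ^^ n) \<eta> x) D" "L1_norm D \<le> (5 / 6) ^ n"
          and L: "(?L ^^ n) \<eta> \<in> circle_L1" "circle_int ((?L ^^ n) \<eta>) = 1" by blast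
        obtain D' where D': "has_weak_deriv (\<lambda>x. h \<epsilon> x - ?L ((?L ^^ n) \<eta>) x) D'"
          "L1_norm D' \<le> (2 / 3 + 2 * \<epsilon> + 20 * \<delta> * A * \<epsilon>) * L1_norm D"
          "?L ((?L ^^ n) \<eta>) \<in> circle_L1" "circle_int (?L ((?L ^^ n) \<eta>)) = 1"
          using self_consistent_op_contracts[OF dens h' inv H A less_imp_le[OF \<delta>] L D(1)] by blast
        have "L1_norm D' \<le> 5 / 6 * (5 / 6) ^ n"
          using D'(2) mult_mono[OF rate[OF rng] D(2)] L1_norm_nonneg[of D] by simp
        with D' show ?case by auto
      qed
      then obtain D where D: "has_weak_deriv (\<lambda>x. h \<epsilon> x - (?L ^^ n) \<eta> x) D" "L1_norm D \<le> (5 / 6) ^ n"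
        and L: "(?L ^^ n) \<eta> \<in> circle_L1" "circle_int ((?L ^^ n) \<eta>) = 1" by blast
      have "circle_int (\<lambda>x. h \<epsilon> x - (?L ^^ n) \<eta> x) = 0"
        using circle_int_diff[OF _ L(1), of "h \<epsilon>"] dens L(2) by (simp add: prob_density_def)
      then have "L1_norm (\<lambda>x. h \<epsilon> x - (?L ^^ n) \<eta> x) + L1_norm D \<le> 3 * (5 / 6) ^ n"
        using poincare[OF D(1)] D(2) by linarith
      also have "(5 / 6) ^ n = exp (- ln (6 / 5) * real n)"
        by (simp add: powr_def ln_div mult.commute flip: powr_realpow)
      finally show ?thesis
        unfolding W1_norm_1_eq[OF D(1)] by (rule ennreal_leI)
    qed
    show "\<exists>C>0. \<exists>\<rho>>0. \<exists>lam>0. \<forall>\<epsilon>\<in>{0..\<epsilon>\<^sub>0}. \<forall>\<eta>.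
              prob_density \<eta> \<and> \<eta> \<in> W1 1 \<and> W1_norm 1 (\<lambda>x. h \<epsilon> x - \<eta> x) \<le> ennreal \<rho> \<longrightarrow>
              (\<forall>n::nat. W1_norm 1 (\<lambda>x. h \<epsilon> x - (self_consistent_op (T \<epsilon>) H \<delta> ^^ n) \<eta> x)
                          \<le> ennreal (C * exp (- lam * real n)))"
    proof (intro exI conjI ballI allI impI; (elim conjE)?)
      show "(3::real) > 0" "(1::real) > 0" "ln (6 / 5 :: real) > 0" by auto
    qed (rule main)
  qed
qed

end
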